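(* Let $d,\varepsilon,k,\delta>0$ be constants ($k\ge2$ an integer) such that $\varepsilon^2d<(1-\delta)k^2$. There is a constant $c=c(d,\varepsilon,k)>0$ such that the following holds. For each $n$ let $f=f_n:\{0,1\}^{n\times n}\to\mathbb{R}$ be any function and let $i,j\in[n]$ be distinct. Suppose $\mathbb{E}_{x\sim G(n,d/n)}f(x)=0$ and that $$\frac{\mathbb{E}_{(x,\sigma)\sim \mathrm{SBM}(n,d,\varepsilon,k)}\ f(x)\big(\mathbf{1}_{\sigma_i=\sigma_j}-\tfrac1k\big)}{\big(\mathbb{E}_{x\sim G(n,d/n)}f(x)^2\big)^{1/2}}\ \ge\ \Omega(1),$$ i.e. the left-hand side is bounded below by a positive constant independent of $n$. Then $\deg f\ge n^{c}$ for all sufficiently large $n$.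
   Context: Graphs on $[n]$ are represented by adjacency matrices $x\in\{0,1\}^{n\times n}$; $\deg f$ is the degree of $f$ as a (multilinear) polynomial in the edge indicators $x_{ab}$, $a<b$. $\mathrm{SBM}(n,d,\varepsilon,k)$ is the $k$-community stochastic block model: draw $\sigma\in[k]^n$ uniformly; independently for each pair $a\neq b$, add the edge $\{a,b\}$ with probability $(1+(1-\frac1k)\varepsilon)\frac dn$ if $\sigma_a=\sigma_b$ and with probability $(1-\frac{\varepsilon}{k})\frac dn$ otherwise (parameters are such that these are valid probabilities for large $n$). $G(n,d/n)$ is the Erdős–Rényi random graph with edge probability $d/n$. *)

theory Defs
  imports "HOL-Probability.Probability"
begin

(* A graph on [n] = {1..n} is its 0/1 adjacency matrix, encoded as a Boolean function of two
   indices that is False outside [n] x [n]. *)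

definition adjacency_matrices :: "nat \<Rightarrow> (nat \<Rightarrow> nat \<Rightarrow> bool) set" where
  "adjacency_matrices n =
     {x. \<forall>a b. x a b \<longrightarrow> a \<in> {1..n} \<and> b \<in> {1..n} \<and> a \<noteq> b \<and> x b a}"

definition vertex_pairs :: "nat \<Rightarrow> (nat \<times> nat) set" where
  "vertex_pairs n = {(a, b). a \<in> {1..n} \<and> b \<in> {1..n} \<and> a < b}"

definition multilinear_eval ::
  "nat \<Rightarrow> ((nat \<times> nat) set \<Rightarrow> real) \<Rightarrow> (nat \<Rightarrow> nat \<Rightarrow> bool) \<Rightarrow> real" where
  "multilinear_eval n c x =
     (\<Sum>S\<in>Pow (vertex_pairs n). c S * (\<Prod>(a, b)\<in>S. of_bool (x a b)))"

definition multilinear_expansion ::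
  "nat \<Rightarrow> ((nat \<Rightarrow> nat \<Rightarrow> bool) \<Rightarrow> real) \<Rightarrow> ((nat \<times> nat) set \<Rightarrow> real) \<Rightarrow> bool" where
  "multilinear_expansion n f c \<longleftrightarrow>
     (\<forall>S. \<not> S \<subseteq> vertex_pairs n \<longrightarrow> c S = 0) \<and>
     (\<forall>x\<in>adjacency_matrices n. f x = multilinear_eval n c x)"

definition graph_of_edges :: "(nat \<times> nat \<Rightarrow> bool) \<Rightarrow> nat \<Rightarrow> nat \<Rightarrow> bool" where
  "graph_of_edges E a b = E (min a b, max a b)"

lemma finite_vertex_pairs: "finite (vertex_pairs n)"
  by (rule finite_subset[of _ "{1..n} \<times> {1..n}"]) (auto simp: vertex_pairs_def)

lemma subset_sum_ex1:
  fixes g :: "'a set \<Rightarrow> real"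
  assumes U: "finite U"
  shows "\<exists>!c. (\<forall>S. \<not> S \<subseteq> U \<longrightarrow> c S = 0) \<and> (\<forall>S. S \<subseteq> U \<longrightarrow> g S = (\<Sum>T\<in>Pow S. c T))"
proof (rule ex_ex1I)
  define c where "c S = (if S \<subseteq> U
      then (-1) ^ card S * (\<Sum>T\<in>Pow S. (-1) ^ card T * g T) else 0)" for S
  have "g S = (\<Sum>T\<in>Pow S. c T)" if S: "S \<subseteq> U" for S
  proof -
    have "finite S" using S U finite_subset by blast
    then have "g S = (\<Sum>T\<in>Pow S. (-1) ^ card T * (\<Sum>R\<in>Pow T. (-1) ^ card R * g R))"
      by (rule inclusion_exclusion_symmetric[OF refl])
    also have "\<dots> = (\<Sum>T\<in>Pow S. c T)"
      using S by (intro sum.cong) (auto simp: c_def)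
    finally show ?thesis .
  qed
  then show "\<exists>c. (\<forall>S. \<not> S \<subseteq> U \<longrightarrow> c S = 0) \<and> (\<forall>S. S \<subseteq> U \<longrightarrow> g S = (\<Sum>T\<in>Pow S. c T))"
    by (intro exI[of _ c]) (auto simp: c_def)
next
  fix c c' :: "'a set \<Rightarrow> real"
  assume c: "(\<forall>S. \<not> S \<subseteq> U \<longrightarrow> c S = 0) \<and> (\<forall>S. S \<subseteq> U \<longrightarrow> g S = (\<Sum>T\<in>Pow S. c T))"
    and c': "(\<forall>S. \<not> S \<subseteq> U \<longrightarrow> c' S = 0) \<and> (\<forall>S. S \<subseteq> U \<longrightarrow> g S = (\<Sum>T\<in>Pow S. c' T))"
  have "S \<subseteq> U \<longrightarrow> c S = c' S" if "finite S" for S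
    using that
  proof (induction rule: finite_psubset_induct)
    case (psubset S)
    show ?case
    proof
      assume S: "S \<subseteq> U"
      have split: "(\<Sum>T\<in>Pow S. b T) = b S + (\<Sum>T\<in>Pow S - {S}. b T)" for b :: "'a set \<Rightarrow> real"
        using psubset.hyps by (intro sum.remove) auto
      have "(\<Sum>T\<in>Pow S - {S}. c T) = (\<Sum>T\<in>Pow S - {S}. c' T)"
        using psubset.IH S by (intro sum.cong) auto
      moreover have "(\<Sum>T\<in>Pow S. c T) = (\<Sum>T\<in>Pow S. c' T)"
        using c c' S by metis
      ultimately show "c S = c' S" using split[of c] split[of c'] by simp
    qed
  qed
  then have "c S = c' S" for S
    using c c' finite_subset[OF _ U, of S] by (cases "S \<subseteq> U") auto
  then show "c = c'" by (rule ext)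
qed

lemma multilinear_expansion_ex1: "\<exists>!c. multilinear_expansion n f c"
proof -
  let ?V = "vertex_pairs n"
  define X where "X S = graph_of_edges (\<lambda>e. e \<in> S)" for S
  have X_adj: "X S \<in> adjacency_matrices n" if "S \<subseteq> ?V" for S
    using that by (auto simp: X_def graph_of_edges_def adjacency_matrices_def vertex_pairs_def
        min_def max_def split: if_splits)
  have surj: "\<exists>S. S \<subseteq> ?V \<and> x = X S" if x: "x \<in> adjacency_matrices n" for x
  proof (intro exI conjI)
    show "{(a, b) \<in> ?V. x a b} \<subseteq> ?V" by auto
    show "x = X {(a, b) \<in> ?V. x a b}"
    proof (intro ext)
      fix a b
      show "x a b = X {(a, b) \<in> ?V. x a b} a b"
        using x unfolding X_def graph_of_edges_def adjacency_matrices_def vertex_pairs_def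
        by (cases a b rule: linorder_cases) (auto simp: min_def max_def)
    qed
  qed
  have eval: "multilinear_eval n c (X S) = (\<Sum>T\<in>Pow S. c T)" if S: "S \<subseteq> ?V" for c S
  proof -
    have mono: "(\<Prod>(a, b)\<in>T. of_bool (X S a b)) = (of_bool (T \<subseteq> S) :: real)"
      if T: "T \<subseteq> ?V" for T
    proof -
      have "finite T" using T finite_vertex_pairs finite_subset by blast
      moreover have "(\<Prod>(a, b)\<in>T. of_bool (X S a b)) = (\<Prod>e\<in>T. of_bool (e \<in> S) :: real)"
        using T by (intro prod.cong)
          (auto simp: X_def graph_of_edges_def vertex_pairs_def min_def max_def)
      ultimately show ?thesis
        by (auto simp: subset_iff intro!: prod.neutral prod_zero)
    qed
    have "multilinear_eval n c (X S) = (\<Sum>T\<in>Pow ?V. if T \<in> Pow S then c T else 0)"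
      unfolding multilinear_eval_def by (intro sum.cong) (auto simp: mono)
    also have "\<dots> = (\<Sum>T\<in>Pow ?V \<inter> Pow S. c T)"
      by (intro sum.inter_restrict[symmetric]) (simp add: finite_vertex_pairs)
    also have "Pow ?V \<inter> Pow S = Pow S" using S by auto
    finally show ?thesis .
  qed
  have "multilinear_expansion n f c \<longleftrightarrow>
      (\<forall>S. \<not> S \<subseteq> ?V \<longrightarrow> c S = 0) \<and> (\<forall>S. S \<subseteq> ?V \<longrightarrow> f (X S) = (\<Sum>T\<in>Pow S. c T))" for c
    unfolding multilinear_expansion_def using surj X_adj eval by metis
  then show ?thesis
    using subset_sum_ex1[OF finite_vertex_pairs, of n "\<lambda>S. f (X S)"] by simp
qed

definition multilinear_coeff ::
  "nat \<Rightarrow> ((nat \<Rightarrow> nat \<Rightarrow> bool) \<Rightarrow> real) \<Rightarrow> (nat \<times> nat) set \<Rightarrow> real" where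
  "multilinear_coeff n f = (THE c. multilinear_expansion n f c)"

(* The zero function gets degree 0. *)

definition multilinear_degree :: "nat \<Rightarrow> ((nat \<Rightarrow> nat \<Rightarrow> bool) \<Rightarrow> real) \<Rightarrow> nat" where
  "multilinear_degree n f = Max (insert 0 (card ` {S. multilinear_coeff n f S \<noteq> 0}))"

(* Independent edges, {a,b} present with probability P a b. bernoulli_pmf clamps its parameter to
   [0,1], and Pi_pmf puts the default value False outside vertex_pairs n, in particular on the
   diagonal. *)

definition independent_edges_pmf ::
  "nat \<Rightarrow> (nat \<Rightarrow> nat \<Rightarrow> real) \<Rightarrow> (nat \<Rightarrow> nat \<Rightarrow> bool) pmf" where
  "independent_edges_pmf n P =
     map_pmf graph_of_edges
       (Pi_pmf (vertex_pairs n) False (\<lambda>(a, b). bernoulli_pmf (P a b)))"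

definition erdos_renyi :: "nat \<Rightarrow> real \<Rightarrow> (nat \<Rightarrow> nat \<Rightarrow> bool) pmf" where
  "erdos_renyi n p = independent_edges_pmf n (\<lambda>_ _. p)"

definition sbm_prob_same :: "nat \<Rightarrow> real \<Rightarrow> real \<Rightarrow> nat \<Rightarrow> real" where
  "sbm_prob_same n d \<epsilon> k = (1 + (1 - 1 / real k) * \<epsilon>) * (d / real n)"

definition sbm_prob_diff :: "nat \<Rightarrow> real \<Rightarrow> real \<Rightarrow> nat \<Rightarrow> real" where
  "sbm_prob_diff n d \<epsilon> k = (1 - \<epsilon> / real k) * (d / real n)"

definition sbm ::
  "nat \<Rightarrow> real \<Rightarrow> real \<Rightarrow> nat \<Rightarrow> ((nat \<Rightarrow> nat \<Rightarrow> bool) \<times> (nat \<Rightarrow> nat)) pmf" where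
  "sbm n d \<epsilon> k =
     bind_pmf (pmf_of_set ({1..n} \<rightarrow>\<^sub>E {1..k})) (\<lambda>\<sigma>.
       map_pmf (\<lambda>x. (x, \<sigma>))
         (independent_edges_pmf n
           (\<lambda>a b. if \<sigma> a = \<sigma> b then sbm_prob_same n d \<epsilon> k else sbm_prob_diff n d \<epsilon> k)))"

end

theory Submission
  imports Defs "HOL-Real_Asymp.Real_Asymp"
begin

text \<open>
  Expanding f in the products of centered edge indicators, which are orthogonal under G(n,p),
  p = d/n, and applying Cauchy--Schwarz bounds the squared correlation by E f(x)^2 times the sum
  over edge sets R with |R| \<le> D = deg f of \<mu>^|R| T(R)^2, where \<mu> = \<epsilon>^2 p/(1-p) and T(R) is the
  mean over \<sigma> of w(i,j) times the product of w(a,b) over R, w(a,b) = 1[\<sigma>_a = \<sigma>_b] - 1/k.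
  Squaring introduces a second replica \<tau> and the overlaps y_ab = w_\<sigma>(a,b) w_\<tau>(a,b). Every mean of
  a product of overlaps is a square, so the elementary symmetric polynomials in the overlaps may be
  replaced by powers of Q/2, Q = \<Sum>_{a,b} y_ab. This leaves the mean of y_ij F(\<mu> Q/2) with F the
  exponential series truncated at D. By exchangeability it is at most the mean of Q F(\<mu> Q/2)
  divided by n(n-1). Finally Q is the sum of the squares of k^2 sums of n independent centered
  variables. Chernoff bounds on moments of order at most n^c, for which only the moment generating
  function near 0 matters, show that the truncated exponential has mean polynomial in D below the
  Kesten--Stigum threshold \<epsilon>^2 d < k^2. For D < n^c with c small the whole bound tends to 0.
\<close>

subsection \<open>Centered monomials in independent edges\<close>

lemma finite_set_Pi_bool:
  assumes "finite V"
  shows "finite (set_pmf (Pi_pmf V False q))"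
proof (rule finite_subset)
  show "set_pmf (Pi_pmf V False q) \<subseteq> PiE_dflt V False (\<lambda>_. UNIV)"
    using set_Pi_pmf_subset[OF assms, of False q] by (auto simp: PiE_dflt_def)
qed (use assms in \<open>auto intro: finite_PiE_dflt\<close>)

lemma expectation_prod_Pi_bool:
  fixes g :: "'e \<Rightarrow> bool \<Rightarrow> real"
  assumes "finite V"
  shows "measure_pmf.expectation (Pi_pmf V False q) (\<lambda>E. \<Prod>e\<in>V. g e (E e)) =
    (\<Prod>e\<in>V. measure_pmf.expectation (q e) (g e))"
proof -
  let ?M = "Pi_pmf V False q"
  have "prob_space.indep_vars ?M (\<lambda>_. borel) (\<lambda>e E. g e (E e)) V"
    by (rule prob_space.indep_vars_compose2[OF measure_pmf.prob_space_axioms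
      indep_vars_Pi_pmf[OF assms]]) auto
  then have "measure_pmf.expectation ?M (\<lambda>E. \<Prod>e\<in>V. g e (E e)) =
      (\<Prod>e\<in>V. measure_pmf.expectation ?M (\<lambda>E. g e (E e)))"
    by (intro prob_space.indep_vars_lebesgue_integral[OF measure_pmf.prob_space_axioms] assms integrable_measure_pmf_finite
        finite_set_Pi_bool)
  also have "\<dots> = (\<Prod>e\<in>V. measure_pmf.expectation (q e) (g e))"
  proof (rule prod.cong[OF refl])
    fix e assume "e \<in> V"
    have "measure_pmf.expectation ?M (\<lambda>E. g e (E e)) =
        measure_pmf.expectation (map_pmf (\<lambda>E. E e) ?M) (g e)"
      by simp
    also have "map_pmf (\<lambda>E. E e) ?M = q e"
      using assms \<open>e \<in> V\<close> by (simp add: Pi_pmf_component)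
    finally show "measure_pmf.expectation ?M (\<lambda>E. g e (E e)) =
        measure_pmf.expectation (q e) (g e)" .
  qed
  finally show ?thesis .
qed

text \<open>Edge indicators before \<open>graph_of_edges\<close> symmetrises them: a product
  measure, so expectations of products over edges factor.\<close>

definition edge_pmf :: "'e set \<Rightarrow> ('e \<Rightarrow> real) \<Rightarrow> ('e \<Rightarrow> bool) pmf" where
  "edge_pmf V P = Pi_pmf V False (\<lambda>e. bernoulli_pmf (P e))"

lemma finite_set_edge_pmf: "finite V \<Longrightarrow> finite (set_pmf (edge_pmf V P))"
  unfolding edge_pmf_def by (rule finite_set_Pi_bool)

lemma integrable_edge_pmf:
  "finite V \<Longrightarrow> integrable (measure_pmf (edge_pmf V P)) (f :: _ \<Rightarrow> real)"
  by (intro integrable_measure_pmf_finite finite_set_edge_pmf)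

text \<open>Left unnormalised, so that under general edge probabilities its mean is a product of
  deviations from \<open>p\<close>. The second moment under the null model is (p(1-p))^|R|, not
  1.\<close>

definition centered_monomial :: "real \<Rightarrow> 'e set \<Rightarrow> ('e \<Rightarrow> bool) \<Rightarrow> real" where
  "centered_monomial p R E = (\<Prod>e\<in>R. of_bool (E e) - p)"

lemma prod_if_subset:
  assumes "finite V" "R \<subseteq> V"
  shows "(\<Prod>e\<in>V. if e \<in> R then g e else 1) = (\<Prod>e\<in>R. g e :: real)"
  using assms by (simp add: prod.If_cases Int_absorb1)

lemma expectation_centered_monomial:
  assumes V: "finite V" "R \<subseteq> V" and P: "\<And>e. e \<in> V \<Longrightarrow> P e \<in> {0..1}"
  shows "measure_pmf.expectation (edge_pmf V P) (centered_monomial p R) = (\<Prod>e\<in>R. P e - p)"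
proof -
  define g where "g e x = (if e \<in> R then of_bool x - p else (1::real))" for e x
  have "centered_monomial p R = (\<lambda>E. \<Prod>e\<in>V. g e (E e))"
    by (simp add: fun_eq_iff centered_monomial_def g_def prod_if_subset[OF V])
  then have "measure_pmf.expectation (edge_pmf V P) (centered_monomial p R) =
      measure_pmf.expectation (edge_pmf V P) (\<lambda>E. \<Prod>e\<in>V. g e (E e))"
    by simp
  also have "\<dots> = (\<Prod>e\<in>V. measure_pmf.expectation (bernoulli_pmf (P e)) (g e))"
    unfolding edge_pmf_def by (rule expectation_prod_Pi_bool[OF V(1)])
  also have "\<dots> = (\<Prod>e\<in>V. if e \<in> R then P e - p else 1)"
    using P by (intro prod.cong refl) (auto simp: g_def algebra_simps)
  also have "\<dots> = (\<Prod>e\<in>R. P e - p)" by (rule prod_if_subset[OF V])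
  finally show ?thesis .
qed

text \<open>The expectation factors over edges: an edge in the symmetric difference contributes the
  mean of a centered variable, which is 0, and a common edge contributes the variance
  p(1-p).\<close>

lemma centered_monomial_orthogonal:
  assumes V: "finite V" "R \<subseteq> V" "S \<subseteq> V" and p: "p \<in> {0..1}"
  shows "measure_pmf.expectation (edge_pmf V (\<lambda>_. p))
      (\<lambda>E. centered_monomial p R E * centered_monomial p S E) =
    (if R = S then (p * (1 - p)) ^ card R else 0)"
proof -
  define g where "g e x = (if e \<in> R then of_bool x - p else 1) *
      (if e \<in> S then of_bool x - p else (1::real))" for e x
  have "(\<lambda>E. centered_monomial p R E * centered_monomial p S E) = (\<lambda>E. \<Prod>e\<in>V. g e (E e))"
    by (simp add: fun_eq_iff centered_monomial_def g_def prod.distrib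
        prod_if_subset[OF V(1,2)] prod_if_subset[OF V(1,3)])
  then have "measure_pmf.expectation (edge_pmf V (\<lambda>_. p))
      (\<lambda>E. centered_monomial p R E * centered_monomial p S E) =
      measure_pmf.expectation (edge_pmf V (\<lambda>_. p)) (\<lambda>E. \<Prod>e\<in>V. g e (E e))"
    by simp
  also have "\<dots> = (\<Prod>e\<in>V. measure_pmf.expectation (bernoulli_pmf p) (g e))"
    unfolding edge_pmf_def by (rule expectation_prod_Pi_bool[OF V(1)])
  also have "\<dots> = (\<Prod>e\<in>V. if e \<in> R then if e \<in> S then p * (1 - p) else 0
      else if e \<in> S then 0 else 1)"
    using p by (intro prod.cong refl) (auto simp: g_def algebra_simps power2_eq_square)
  also have "\<dots> = (if R = S then (p * (1 - p)) ^ card R else 0)"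
  proof (cases "R = S")
    case True
    then have "(\<Prod>e\<in>V. if e \<in> R then if e \<in> S then p * (1 - p) else 0
        else if e \<in> S then 0 else 1) = (\<Prod>e\<in>V. if e \<in> R then p * (1 - p) else 1)"
      by (intro prod.cong) auto
    then show ?thesis using True prod_if_subset[OF V(1,2), of "\<lambda>_. p * (1 - p)"] by simp
  next
    case False
    then obtain e where "e \<in> V" "(e \<in> R) \<noteq> (e \<in> S)" using V by blast
    then show ?thesis using False V by (auto intro!: prod_zero)
  qed
  finally show ?thesis .
qed

text \<open>Writing each indicator as (x_e - p) + p turns a monomial over S into centered monomials
  over subsets of S, so the change of basis does not raise the degree.\<close>

lemma monomial_recentering:
  fixes c :: "'e set \<Rightarrow> real"
  assumes V: "finite V" and c: "\<And>S. card S > D \<Longrightarrow> c S = 0"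
  obtains b where "\<And>R. card R > D \<Longrightarrow> b R = 0"
    and "\<And>E. (\<Sum>S\<in>Pow V. c S * (\<Prod>e\<in>S. of_bool (E e))) =
      (\<Sum>R\<in>Pow V. b R * centered_monomial p R E)"
proof
  define b where "b R = (\<Sum>S\<in>Pow V. if R \<subseteq> S then c S * p ^ card (S - R) else 0)" for R
  show "b R = 0" if "card R > D" for R
    unfolding b_def
  proof (intro sum.neutral ballI)
    fix S assume "S \<in> Pow V"
    then have "finite S" using V finite_subset by auto
    then show "(if R \<subseteq> S then c S * p ^ card (S - R) else 0) = 0"
      using that c[of S] card_mono[of S R] by auto
  qed
  fix E
  have "(\<Sum>S\<in>Pow V. c S * (\<Prod>e\<in>S. of_bool (E e))) =
      (\<Sum>S\<in>Pow V. \<Sum>R\<in>Pow V. if R \<subseteq> S then c S * p ^ card (S - R) * centered_monomial p R E else 0)"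
  proof (rule sum.cong[OF refl])
    fix S assume S: "S \<in> Pow V"
    then have fS: "finite S" using V finite_subset by auto
    have "(\<Prod>e\<in>S. of_bool (E e)) = (\<Prod>e\<in>S. (of_bool (E e) - p) + p)" by simp
    also have "\<dots> = (\<Sum>R\<in>Pow S. centered_monomial p R E * p ^ card (S - R))"
      by (subst prod_add[OF fS]) (simp add: centered_monomial_def)
    also have "\<dots> = (\<Sum>R\<in>Pow V \<inter> Pow S. centered_monomial p R E * p ^ card (S - R))"
      using S by (intro sum.cong) auto
    also have "\<dots> = (\<Sum>R\<in>Pow V. if R \<in> Pow S then centered_monomial p R E * p ^ card (S - R) else 0)"
      using V by (intro sum.inter_restrict) simp
    finally show "c S * (\<Prod>e\<in>S. of_bool (E e)) =
      (\<Sum>R\<in>Pow V. if R \<subseteq> S then c S * p ^ card (S - R) * centered_monomial p R E else 0)"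
      by (simp only: sum_distrib_left) (intro sum.cong refl, auto)
  qed
  also have "\<dots> = (\<Sum>R\<in>Pow V. b R * centered_monomial p R E)"
    unfolding b_def sum_distrib_right
    by (subst sum.swap) (intro sum.cong refl, auto)
  finally show "(\<Sum>S\<in>Pow V. c S * (\<Prod>e\<in>S. of_bool (E e))) =
      (\<Sum>R\<in>Pow V. b R * centered_monomial p R E)" .
qed

text \<open>Parseval under the product measure of density \<open>p\<close>, combined with the linear
  functional that sums over the planted measures. The index \<open>s\<close> stands for a labelling
  and \<open>h\<close> for its weight; sums over \<Omega> stay unnormalised.\<close>

lemma low_degree_Cauchy_Schwarz:
  fixes c :: "'e set \<Rightarrow> real" and P :: "'s \<Rightarrow> 'e \<Rightarrow> real" and h :: "'s \<Rightarrow> real"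
  assumes V: "finite V" and c: "\<And>S. card S > D \<Longrightarrow> c S = 0" and p: "0 < p" "p < 1"
    and P: "\<And>s e. s \<in> \<Omega> \<Longrightarrow> e \<in> V \<Longrightarrow> P s e \<in> {0..1}"
    and F: "F = (\<lambda>E. \<Sum>S\<in>Pow V. c S * (\<Prod>e\<in>S. of_bool (E e)))"
  shows "(\<Sum>s\<in>\<Omega>. h s * measure_pmf.expectation (edge_pmf V (P s)) F)\<^sup>2 \<le>
    measure_pmf.expectation (edge_pmf V (\<lambda>_. p)) (\<lambda>E. (F E)\<^sup>2) *
    (\<Sum>R | R \<subseteq> V \<and> card R \<le> D. (\<Sum>s\<in>\<Omega>. h s * (\<Prod>e\<in>R. P s e - p))\<^sup>2 / (p * (1 - p)) ^ card R)"
proof -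
  obtain b where b0: "\<And>R. card R > D \<Longrightarrow> b R = 0"
    and b: "\<And>E. (\<Sum>S\<in>Pow V. c S * (\<Prod>e\<in>S. of_bool (E e))) =
      (\<Sum>R\<in>Pow V. b R * centered_monomial p R E)"
    using monomial_recentering[where p = p and c = c and V = V and D = D] V c by metis
  define W where "W = {R. R \<subseteq> V \<and> card R \<le> D}"
  have W: "finite W" "\<And>R. R \<in> W \<Longrightarrow> R \<subseteq> V" using V by (auto simp: W_def)
  have Fb: "F E = (\<Sum>R\<in>W. b R * centered_monomial p R E)" for E
    unfolding F b
  proof (rule sum.mono_neutral_right)
    show "\<forall>R\<in>Pow V - W. b R * centered_monomial p R E = 0"
    proof
      fix R assume "R \<in> Pow V - W"
      then have "card R > D" by (auto simp: W_def)
      then show "b R * centered_monomial p R E = 0" by (simp add: b0)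
    qed
  qed (use V in \<open>auto simp: W_def\<close>)
  define m where "m R = (\<Sum>s\<in>\<Omega>. h s * (\<Prod>e\<in>R. P s e - p))" for R
  define q where "q = p * (1 - p)"
  have q: "q > 0" using p by (simp add: q_def)
  have "(\<Sum>s\<in>\<Omega>. h s * measure_pmf.expectation (edge_pmf V (P s)) F) =
      (\<Sum>s\<in>\<Omega>. h s * (\<Sum>R\<in>W. b R * (\<Prod>e\<in>R. P s e - p)))"
  proof (intro sum.cong refl arg_cong2[where f = "(*)"])
    fix s assume s: "s \<in> \<Omega>"
    have "measure_pmf.expectation (edge_pmf V (P s)) F =
        (\<Sum>R\<in>W. measure_pmf.expectation (edge_pmf V (P s)) (\<lambda>E. b R * centered_monomial p R E))"
      unfolding Fb by (rule Bochner_Integration.integral_sum) (rule integrable_edge_pmf[OF V])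
    also have "\<dots> = (\<Sum>R\<in>W. b R * (\<Prod>e\<in>R. P s e - p))"
      using W P s V by (intro sum.cong refl) (simp add: expectation_centered_monomial)
    finally show "measure_pmf.expectation (edge_pmf V (P s)) F =
      (\<Sum>R\<in>W. b R * (\<Prod>e\<in>R. P s e - p))" .
  qed
  also have "\<dots> = (\<Sum>R\<in>W. b R * m R)"
    unfolding m_def sum_distrib_left by (subst sum.swap) (simp add: mult_ac)
  \<comment> \<open>The weight sqrt(q^|R|) is the norm of the centered monomial, so the first
    Cauchy--Schwarz factor becomes the second moment of \<open>F\<close>.\<close>
  also have "\<dots> = (\<Sum>R\<in>W. (b R * sqrt (q ^ card R)) * (m R / sqrt (q ^ card R)))"
    using q by (intro sum.cong) auto
  also have "\<dots>\<^sup>2 \<le> (\<Sum>R\<in>W. (b R * sqrt (q ^ card R))\<^sup>2) * (\<Sum>R\<in>W. (m R / sqrt (q ^ card R))\<^sup>2)"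
    by (rule Cauchy_Schwarz_ineq_sum)
  also have "(\<Sum>R\<in>W. (m R / sqrt (q ^ card R))\<^sup>2) = (\<Sum>R\<in>W. (m R)\<^sup>2 / q ^ card R)"
    using q by (simp add: power_divide)
  also have "(\<Sum>R\<in>W. (b R * sqrt (q ^ card R))\<^sup>2) = (\<Sum>R\<in>W. (b R)\<^sup>2 * q ^ card R)"
    using q by (simp add: power_mult_distrib)
  also have "\<dots> = measure_pmf.expectation (edge_pmf V (\<lambda>_. p)) (\<lambda>E. (F E)\<^sup>2)"
  proof -
    have "measure_pmf.expectation (edge_pmf V (\<lambda>_. p)) (\<lambda>E. (F E)\<^sup>2) =
        measure_pmf.expectation (edge_pmf V (\<lambda>_. p)) (\<lambda>E. \<Sum>R\<in>W. \<Sum>S\<in>W.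
          b R * b S * (centered_monomial p R E * centered_monomial p S E))"
      unfolding Fb power2_eq_square sum_product by (simp add: mult_ac)
    also have "\<dots> = (\<Sum>R\<in>W. \<Sum>S\<in>W. b R * b S * measure_pmf.expectation (edge_pmf V (\<lambda>_. p))
        (\<lambda>E. centered_monomial p R E * centered_monomial p S E))"
      by (simp add: Bochner_Integration.integral_sum integrable_edge_pmf[OF V])
    also have "\<dots> = (\<Sum>R\<in>W. \<Sum>S\<in>W. if R = S then b R * b S * q ^ card R else 0)"
      using W p by (intro sum.cong refl)
        (simp add: centered_monomial_orthogonal[OF V] q_def)
    also have "\<dots> = (\<Sum>R\<in>W. (b R)\<^sup>2 * q ^ card R)"
      using W(1) by (simp add: power2_eq_square)
    finally show ?thesis by simp
  qed
  finally show ?thesis by (simp add: m_def q_def W_def)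
qed

subsection \<open>The replica order\<close>

text \<open>Finite sums of kernels u(x) u(y): a cone closed under products on which the double
  average is nonnegative, so that it orders functions of two replicas.\<close>

inductive replica_pos :: "('s \<Rightarrow> 's \<Rightarrow> real) \<Rightarrow> bool" where
  rank1: "replica_pos (\<lambda>x y. u x * u y)"
| add: "replica_pos f \<Longrightarrow> replica_pos g \<Longrightarrow> replica_pos (\<lambda>x y. f x y + g x y)"

lemma replica_pos_const: "0 \<le> c \<Longrightarrow> replica_pos (\<lambda>_ _. c)"
  using rank1[of "\<lambda>_. sqrt c"] by simp

text \<open>Two rank-one kernels multiply to the rank-one kernel of the product function; the rest
  is distributivity. This is the Schur product theorem for the cone.\<close>

lemma replica_pos_mult:
  assumes "replica_pos f" "replica_pos g"
  shows "replica_pos (\<lambda>x y. f x y * g x y)"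
  using assms
proof (induction f)
  case (rank1 u)
  from rank1 show ?case
  proof (induction g)
    case (rank1 v)
    then show ?case using replica_pos.rank1[of "\<lambda>x. u x * v x"] by (simp add: mult_ac)
  next
    case (add f g)
    then show ?case using replica_pos.add by (fastforce simp: distrib_left)
  qed
next
  case (add f f')
  then show ?case using replica_pos.add by (fastforce simp: distrib_right)
qed

lemma replica_pos_sum:
  assumes "\<And>i. i \<in> I \<Longrightarrow> replica_pos (f i)"
  shows "replica_pos (\<lambda>x y. \<Sum>i\<in>I. f i x y)"
  using assms
  by (induction I rule: infinite_finite_induct) (auto intro: replica_pos.add replica_pos_const)

lemma replica_pos_power: "replica_pos f \<Longrightarrow> replica_pos (\<lambda>x y. f x y ^ l)"
  by (induction l) (auto intro: replica_pos_mult replica_pos_const)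

lemma sum_replica_pos_nonneg:
  assumes "replica_pos f"
  shows "0 \<le> (\<Sum>x\<in>A. \<Sum>y\<in>A. f x y)"
  using assms
proof induction
  case (rank1 u)
  have "(\<Sum>x\<in>A. \<Sum>y\<in>A. u x * u y) = (sum u A)\<^sup>2"
    by (simp add: power2_eq_square sum_product)
  then show ?case by simp
qed (simp add: sum.distrib)

text \<open>Deliberately not a pointwise order: overlaps change sign, so a pointwise bound would not
  survive multiplication by an overlap. This order survives it and still compares double
  averages.\<close>

definition replica_le :: "('s \<Rightarrow> 's \<Rightarrow> real) \<Rightarrow> ('s \<Rightarrow> 's \<Rightarrow> real) \<Rightarrow> bool" where
  "replica_le f g \<longleftrightarrow> replica_pos (\<lambda>x y. g x y - f x y)"

lemma replica_le_trans: "replica_le f g \<Longrightarrow> replica_le g h \<Longrightarrow> replica_le f h"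
  unfolding replica_le_def using replica_pos.add[of "\<lambda>x y. g x y - f x y" "\<lambda>x y. h x y - g x y"]
  by simp

lemma replica_le_refl: "replica_le f f"
  by (simp add: replica_le_def replica_pos_const)

lemma replica_le_add:
  "replica_le f g \<Longrightarrow> replica_le f' g' \<Longrightarrow>
    replica_le (\<lambda>x y. f x y + f' x y) (\<lambda>x y. g x y + g' x y)"
  unfolding replica_le_def by (drule (1) replica_pos.add) (simp add: algebra_simps)

lemma replica_le_mult_left:
  "replica_pos h \<Longrightarrow> replica_le f g \<Longrightarrow> replica_le (\<lambda>x y. h x y * f x y) (\<lambda>x y. h x y * g x y)"
  unfolding replica_le_def by (drule (1) replica_pos_mult) (simp add: algebra_simps)

text \<open>The chain f^(l+1) <= f g^l <= g^(l+1), where each step multiplies by an element of the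
  cone.\<close>

lemma replica_le_power:
  assumes "replica_pos f" "replica_pos g" "replica_le f g"
  shows "replica_le (\<lambda>x y. f x y ^ l) (\<lambda>x y. g x y ^ l)"
proof (induction l)
  case (Suc l)
  have "replica_le (\<lambda>x y. f x y * f x y ^ l) (\<lambda>x y. f x y * g x y ^ l)"
    by (rule replica_le_mult_left[OF assms(1) Suc])
  moreover have "replica_le (\<lambda>x y. g x y ^ l * f x y) (\<lambda>x y. g x y ^ l * g x y)"
    by (rule replica_le_mult_left[OF replica_pos_power[OF assms(2)] assms(3)])
  ultimately show ?case by (auto simp: mult.commute intro: replica_le_trans)
qed (simp add: replica_le_refl)

text \<open>The first two terms of the binomial expansion are kept; the dropped ones are products of
  elements of the cone with nonnegative coefficients. This drives the induction over the ground set
  in the next lemma.\<close>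

lemma replica_le_add_power:
  assumes f: "replica_pos f" and g: "replica_pos g"
  shows "replica_le (\<lambda>x y. f x y ^ Suc l + real (Suc l) * g x y * f x y ^ l)
    (\<lambda>x y. (f x y + g x y) ^ Suc l)"
proof -
  have "(f x y + g x y) ^ Suc l - (f x y ^ Suc l + real (Suc l) * g x y * f x y ^ l) =
      (\<Sum>i\<in>{2..Suc l}. real (Suc l choose i) * (g x y ^ i * f x y ^ (Suc l - i)))" for x y
  proof -
    have "(f x y + g x y) ^ Suc l =
        (\<Sum>i\<in>{..Suc l}. real (Suc l choose i) * (g x y ^ i * f x y ^ (Suc l - i)))"
      by (subst add.commute, subst binomial_ring) (simp add: mult_ac)
    also have "{..Suc l} = insert 0 (insert 1 {2..Suc l})" by auto
    finally show ?thesis by simp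
  qed
  then show ?thesis unfolding replica_le_def
    by (simp only:) (intro replica_pos_sum replica_pos_mult replica_pos_power replica_pos_const f g, simp)
qed

text \<open>The right-hand side also counts the tuples with repeated elements.\<close>

lemma fact_elementary_symmetric_replica_le:
  fixes y :: "'e \<Rightarrow> 's \<Rightarrow> 's \<Rightarrow> real"
  assumes "finite V" "\<And>e. e \<in> V \<Longrightarrow> replica_pos (y e)"
  shows "replica_le (\<lambda>s t. fact l * (\<Sum>R | R \<subseteq> V \<and> card R = l. \<Prod>e\<in>R. y e s t))
    (\<lambda>s t. (\<Sum>e\<in>V. y e s t) ^ l)"
  using assms
proof (induction V arbitrary: l rule: finite_induct)
  case empty
  show ?case
  proof (cases "l = 0")
    case True
    have "{R :: 'e set. R \<subseteq> {} \<and> card R = l} = {{}}" using True by auto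
    then show ?thesis by (simp only: True) (simp add: replica_le_refl)
  next
    case False
    then have "{R :: 'e set. R \<subseteq> {} \<and> card R = l} = {}" by auto
    then show ?thesis by (simp only:) (simp add: replica_le_refl power_0_left False)
  qed
next
  case (insert v V)
  define e where "e l s t = (\<Sum>R | R \<subseteq> V \<and> card R = l. \<Prod>e\<in>R. y e s t)" for l s t
  define Y where "Y s t = (\<Sum>e\<in>V. y e s t)" for s t
  have IH: "replica_le (\<lambda>s t. fact l * e l s t) (\<lambda>s t. Y s t ^ l)" for l
    unfolding e_def Y_def using insert.IH insert.prems by auto
  have v: "replica_pos (y v)" and Y: "replica_pos Y"
    using insert.prems unfolding Y_def by (auto intro!: replica_pos_sum)
  have sumY: "(\<Sum>e\<in>insert v V. y e s t) = Y s t + y v s t" for s t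
    using insert.hyps by (simp add: Y_def)
  show ?case
  proof (cases l)
    case 0
    have "card R = l \<longleftrightarrow> R = {}" if "R \<subseteq> insert v V" for R
      using finite_subset[OF that] insert.hyps 0 by simp
    then have "{R. R \<subseteq> insert v V \<and> card R = l} = {{}}" by auto
    then show ?thesis using 0 by (simp add: replica_le_refl)
  next
    case (Suc m)
    \<comment> \<open>A subset of size l either avoids \<open>v\<close> or arises from a subset of
      size m = l - 1 by inserting \<open>v\<close>.\<close>
    have split: "{R. R \<subseteq> insert v V \<and> card R = l} =
        {R. R \<subseteq> V \<and> card R = l} \<union> insert v ` {R. R \<subseteq> V \<and> card R = m}" (is "?A = ?B \<union> ?C")
    proof (intro equalityI subsetI)
      fix R assume R: "R \<in> ?A"
      then have fR: "finite R" using insert.hyps finite_subset[of R "insert v V"] by auto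
      show "R \<in> ?B \<union> ?C"
      proof (cases "v \<in> R")
        case True
        then have "R = insert v (R - {v})" "R - {v} \<subseteq> V" "card (R - {v}) = m"
          using R Suc fR by auto
        then show ?thesis by blast
      qed (use R in auto)
    next
      fix R assume "R \<in> ?B \<union> ?C"
      then consider "R \<in> ?B" | S where "S \<subseteq> V" "card S = m" "R = insert v S" by auto
      then show "R \<in> ?A"
      proof cases
        case 2
        then have "finite S" "v \<notin> S" using insert.hyps finite_subset[of S V] by auto
        then show ?thesis using 2 Suc by auto
      qed auto
    qed
    have inj: "inj_on (insert v) {R. R \<subseteq> V \<and> card R = m}"
    proof (rule inj_onI)
      fix R S assume "R \<in> {R. R \<subseteq> V \<and> card R = m}" "S \<in> {R. R \<subseteq> V \<and> card R = m}"
        and eq: "insert v R = insert v S"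
      then have "v \<notin> R" "v \<notin> S" using insert.hyps by auto
      then show "R = S" using eq by (simp add: insert_ident)
    qed
    have fin: "finite V" by (rule insert.hyps)
    have "(\<Sum>R | R \<subseteq> insert v V \<and> card R = l. \<Prod>e\<in>R. y e s t) = e l s t + y v s t * e m s t" for s t
    proof -
      have "(\<Sum>R\<in>?C. \<Prod>e\<in>R. y e s t) = (\<Sum>R | R \<subseteq> V \<and> card R = m. \<Prod>e\<in>insert v R. y e s t)"
        by (simp add: sum.reindex[OF inj])
      also have "\<dots> = y v s t * e m s t"
        unfolding e_def sum_distrib_left using insert.hyps
        by (intro sum.cong refl prod.insert) (auto dest: finite_subset)
      finally have "(\<Sum>R\<in>?C. \<Prod>e\<in>R. y e s t) = y v s t * e m s t" .
      moreover have "?B \<inter> ?C = {}" using insert.hyps by auto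
      ultimately show ?thesis unfolding split e_def
        using fin by (subst sum.union_disjoint) auto
    qed
    \<comment> \<open>Since l! = l m!, the recursion takes the shape of the first two terms of a
      binomial expansion.\<close>
    then have eq: "fact l * (\<Sum>R | R \<subseteq> insert v V \<and> card R = l. \<Prod>e\<in>R. y e s t) =
        fact l * e l s t + real l * y v s t * (fact m * e m s t)" for s t
      by (simp add: Suc algebra_simps)
    have "replica_le (\<lambda>s t. fact l * e l s t + real l * y v s t * (fact m * e m s t))
        (\<lambda>s t. Y s t ^ l + real l * y v s t * Y s t ^ m)"
      by (intro replica_le_add replica_le_mult_left IH replica_pos_mult replica_pos_const v) simp
    moreover have "replica_le (\<lambda>s t. Y s t ^ l + real l * y v s t * Y s t ^ m)
        (\<lambda>s t. (Y s t + y v s t) ^ l)"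
      unfolding Suc by (rule replica_le_add_power[OF Y v])
    ultimately show ?thesis
      unfolding eq sumY by (rule replica_le_trans)
  qed
qed

subsection \<open>Truncated exponential moments of the overlap\<close>

text \<open>Stirling's upper bound up to a factor of order sqrt l, by induction from (1 -
  1/(l+1))^(l+1) <= 1/e.\<close>

lemma fact_le_power_exp:
  assumes "l \<ge> 1"
  shows "fact l * exp (real l) \<le> exp 1 * real l * real l ^ l"
  using assms
proof (induction l rule: nat_induct_at_least)
  case (Suc l)
  have "1 - 1 / real (Suc l) \<le> exp (- (1 / real (Suc l)))"
    using exp_ge_add_one_self[of "- (1 / real (Suc l))"] by simp
  then have "(real l / real (Suc l)) ^ Suc l \<le> exp (- (1 / real (Suc l))) ^ Suc l"
    by (intro power_mono) (auto simp: field_simps)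
  also have "\<dots> = exp (-1)"
    by (simp add: exp_of_nat_mult[symmetric] del: power_Suc)
  finally have "exp 1 * real l ^ Suc l \<le> real (Suc l) ^ Suc l"
    by (simp add: power_divide exp_minus field_simps del: power_Suc)
  then have step: "exp 1 * (real l * real l ^ l) \<le> real (Suc l) ^ Suc l" by simp
  have "fact (Suc l) * exp (real (Suc l)) = real (Suc l) * exp 1 * (fact l * exp (real l))"
    by (simp add: exp_add algebra_simps)
  also have "\<dots> \<le> real (Suc l) * exp 1 * (exp 1 * real l * real l ^ l)"
    by (rule mult_left_mono[OF Suc.IH]) simp
  also have "\<dots> = exp 1 * real (Suc l) * (exp 1 * (real l * real l ^ l))" by simp
  also have "\<dots> \<le> exp 1 * real (Suc l) * real (Suc l) ^ Suc l"
    by (rule mult_left_mono[OF step]) simp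
  finally show ?case .
qed simp

text \<open>One term of a series with nonnegative terms. It lets a moment be bounded by a moment
  generating function.\<close>

lemma even_power_le_cosh: "x ^ (2 * l) / fact (2 * l) \<le> cosh (x :: real)"
proof -
  have "(\<Sum>n\<in>{2 * l}. if even n then x ^ n /\<^sub>R fact n else 0) \<le>
      (\<Sum>n. if even n then x ^ n /\<^sub>R fact n else 0)"
    by (rule sum_le_suminf) (use cosh_converges[of x] in \<open>auto simp: sums_iff zero_le_even_power\<close>)
  then show ?thesis using cosh_converges[of x] by (simp add: sums_iff divide_inverse mult_ac)
qed

lemma fact_double_le: "fact (2 * l) \<le> (4 ^ l * (fact l)\<^sup>2 :: real)"
proof -
  have "(fact (2 * l) :: real) = fact l * fact (2 * l - l) * real (2 * l choose l)"
    by (subst binomial_fact) auto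
  also have "\<dots> \<le> fact l * fact (2 * l - l) * 2 ^ (2 * l)"
  proof (rule mult_left_mono)
    have "real (2 * l choose l) \<le> real (2 ^ (2 * l))"
      by (subst of_nat_le_iff) (rule binomial_le_pow2)
    then show "real (2 * l choose l) \<le> 2 ^ (2 * l)" by simp
  qed simp
  also have "(2::real) ^ (2 * l) = 4 ^ l" by (simp add: power_mult)
  finally show ?thesis by (simp add: power2_eq_square mult_ac)
qed

text \<open>The scale is the one minimising the Chernoff bound for the moment of order 2l of a centered
  Gaussian of variance \<kappa>.\<close>

lemma power_le_scaled_cosh:
  fixes \<kappa> \<mu> x :: real
  assumes \<kappa>: "0 < \<kappa>" and \<mu>: "0 \<le> \<mu>" "\<mu> * \<kappa> \<le> 1"
  shows "(\<mu> * x\<^sup>2 / 2) ^ l / fact l \<le>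
    exp 1 * real (l + 1) * exp (- real l) * cosh (sqrt (2 * real l / \<kappa>) * x)"
proof (cases "l = 0")
  case False
  define s where "s = sqrt (2 * real l / \<kappa>)"
  have s2: "s\<^sup>2 = 2 * real l / \<kappa>" and s0: "s > 0"
    using \<kappa> False by (auto simp: s_def)
  have "(s * x) ^ (2 * l) \<le> fact (2 * l) * cosh (s * x)"
    using even_power_le_cosh[of "s * x" l] by (simp add: field_simps)
  also have "\<dots> \<le> 4 ^ l * (fact l)\<^sup>2 * cosh (s * x)"
    by (intro mult_right_mono fact_double_le) (simp add: cosh_real_nonneg)
  finally have "(s\<^sup>2 * x\<^sup>2) ^ l \<le> 4 ^ l * (fact l)\<^sup>2 * cosh (s * x)"
    by (simp add: power_mult power_mult_distrib)
  then have 1: "(2 * real l / \<kappa> * x\<^sup>2) ^ l \<le> 4 ^ l * (fact l)\<^sup>2 * cosh (s * x)"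
    by (simp only: s2)
  \<comment> \<open>The power of \<mu>\<kappa> is isolated; it is at most 1 and is dropped in the
    next step.\<close>
  have "(\<mu> * x\<^sup>2 / 2) ^ l / fact l =
      (\<mu> * \<kappa>) ^ l / (4 ^ l * real l ^ l * fact l) * (2 * real l / \<kappa> * x\<^sup>2) ^ l"
  proof -
    have "\<mu> * x\<^sup>2 / 2 = (\<mu> * \<kappa>) / (4 * real l) * (2 * real l / \<kappa> * x\<^sup>2)"
      using \<kappa> False by (simp add: field_simps)
    then have "(\<mu> * x\<^sup>2 / 2) ^ l = (\<mu> * \<kappa>) ^ l / (4 ^ l * real l ^ l) * (2 * real l / \<kappa> * x\<^sup>2) ^ l"
      by (simp only: power_mult_distrib power_divide)
    then show ?thesis by simp
  qed
  also have "\<dots> \<le> 1 / (4 ^ l * real l ^ l * fact l) * (4 ^ l * (fact l)\<^sup>2 * cosh (s * x))"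
    using \<kappa> \<mu> by (intro mult_mono 1 divide_right_mono power_le_one) auto
  also have "\<dots> = fact l / real l ^ l * cosh (s * x)"
    by (simp add: power2_eq_square)
  \<comment> \<open>Stirling turns l!/l^l into a polynomial factor times exp(-l). The factor l+1 in
    place of l keeps the bound valid at l = 0.\<close>
  also have "\<dots> \<le> (exp 1 * real (l + 1) * exp (- real l)) * cosh (s * x)"
  proof (rule mult_right_mono)
    have "fact l * exp (real l) \<le> exp 1 * real l * real l ^ l"
      using fact_le_power_exp[of l] False by simp
    also have "\<dots> \<le> exp 1 * real (l + 1) * real l ^ l"
      by (intro mult_right_mono mult_left_mono) auto
    finally show "fact l / real l ^ l \<le> exp 1 * real (l + 1) * exp (- real l)"
      using False by (simp add: exp_minus field_simps)
  qed (simp add: cosh_real_nonneg)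
  finally show ?thesis by (simp add: s_def)
qed simp

section \<open>The truncated exponential series\<close>

definition truncated_exp :: "nat \<Rightarrow> real \<Rightarrow> real" where
  "truncated_exp D z = (\<Sum>l\<le>D. z ^ l / fact l)"

lemma truncated_exp_nonneg: "0 \<le> z \<Longrightarrow> 0 \<le> truncated_exp D z"
  unfolding truncated_exp_def by (intro sum_nonneg) auto

text \<open>The left side consists of the terms with i + j <= D of the product on the right; the
  remaining terms are nonnegative.\<close>

lemma truncated_exp_add:
  assumes "0 \<le> a" "0 \<le> b"
  shows "truncated_exp D (a + b) \<le> truncated_exp D a * truncated_exp D b"
proof -
  have "truncated_exp D (a + b) = (\<Sum>l\<le>D. \<Sum>i\<le>l. a ^ i / fact i * (b ^ (l - i) / fact (l - i)))"
    unfolding truncated_exp_def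
  proof (rule sum.cong[OF refl])
    fix l :: nat
    show "(a + b) ^ l / fact l = (\<Sum>i\<le>l. a ^ i / fact i * (b ^ (l - i) / fact (l - i)))"
      unfolding binomial_ring sum_divide_distrib
      by (intro sum.cong refl) (simp add: binomial_fact)
  qed
  also have "\<dots> = (\<Sum>(i, j)\<in>{(i, j). i + j \<le> D}. a ^ i / fact i * (b ^ j / fact j))"
    by (rule sum.triangle_reindex_eq[symmetric])
  also have "\<dots> \<le> (\<Sum>(i, j)\<in>{..D} \<times> {..D}. a ^ i / fact i * (b ^ j / fact j))"
    using assms by (intro sum_mono2) auto
  also have "\<dots> = truncated_exp D a * truncated_exp D b"
    unfolding truncated_exp_def sum_product by (rule sum.cartesian_product[symmetric])
  finally show ?thesis .
qed

lemma truncated_exp_sum: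
  assumes "finite C" "\<And>c. c \<in> C \<Longrightarrow> 0 \<le> z c"
  shows "truncated_exp D (\<Sum>c\<in>C. z c) \<le> (\<Prod>c\<in>C. truncated_exp D (z c))"
  using assms
proof (induction C rule: finite_induct)
  case empty
  have "(\<Sum>l\<le>D. (0::real) ^ l / fact l) = (\<Sum>l\<in>{0}. 0 ^ l / fact l)"
    by (rule sum.mono_neutral_right) auto
  then show ?case by (simp add: truncated_exp_def)
next
  case (insert c C)
  have "truncated_exp D (\<Sum>c\<in>insert c C. z c) \<le> truncated_exp D (z c) * truncated_exp D (\<Sum>c\<in>C. z c)"
    using insert by (simp add: truncated_exp_add sum_nonneg)
  also have "\<dots> \<le> truncated_exp D (z c) * (\<Prod>c\<in>C. truncated_exp D (z c))"
    using insert by (intro mult_left_mono truncated_exp_nonneg) auto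
  finally show ?case using insert by simp
qed

text \<open>Multiplication by z shifts the series: z z^l/l! = (l+1) z^(l+1)/(l+1)!. This will absorb
  the factor produced by averaging over pairs, at the price of one more order in the
  truncation.\<close>

lemma mult_truncated_exp_le:
  assumes "0 \<le> z"
  shows "z * truncated_exp D z \<le> real (D + 1) * truncated_exp (D + 1) z"
proof -
  have "z * truncated_exp D z = (\<Sum>l\<le>D. real (Suc l) * (z ^ Suc l / fact (Suc l)))"
    unfolding truncated_exp_def sum_distrib_left
    by (intro sum.cong refl) (simp add: field_simps del: of_nat_Suc)
  also have "\<dots> \<le> (\<Sum>l\<le>D. real (D + 1) * (z ^ Suc l / fact (Suc l)))"
    using assms by (intro sum_mono mult_right_mono) auto
  also have "\<dots> \<le> real (D + 1) * truncated_exp (D + 1) z"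
    unfolding truncated_exp_def sum_distrib_left[symmetric]
    using assms by (intro mult_left_mono) (auto simp: sum.atMost_Suc_shift simp del: sum.atMost_Suc)
  finally show ?thesis .
qed

section \<open>Moment generating functions of centered label counts\<close>

lemma exp_le_quadratic:
  assumes "\<bar>x\<bar> \<le> r"
  shows "exp x \<le> 1 + x + exp r * x\<^sup>2 / (2::real)"
proof -
  \<comment> \<open>Lagrange remainder. Keeping exp r instead of a fixed constant leaves the
    variance proxy within a factor exp r of the true variance, which is what reaches the sharp
    threshold.\<close>
  obtain t where t: "\<bar>t\<bar> \<le> \<bar>x\<bar>" "exp x = (\<Sum>m<2. x ^ m / fact m) + exp t / fact 2 * x ^ 2"
    using Maclaurin_exp_le[of x 2] by auto
  have "exp x = 1 + x + exp t * x\<^sup>2 / 2"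
    using t(2) by (simp add: lessThan_Suc numeral_2_eq_2)
  also have "exp t * x\<^sup>2 \<le> exp r * x\<^sup>2" using t(1) assms by (intro mult_right_mono) auto
  finally show ?thesis by simp
qed

text \<open>Coordinate r of the vector e_s minus the barycenter of the standard basis, s being the
  label. On labels in \<open>B\<close>, \<open>agreement\<close> below is the Gram matrix of these
  vectors.\<close>

definition centered_indicator :: "nat set \<Rightarrow> nat \<Rightarrow> nat \<Rightarrow> real" where
  "centered_indicator B r s = of_bool (s = r) - 1 / real (card B)"

lemma sum_centered_indicator:
  assumes "finite B" "B \<noteq> {}" "r \<in> B"
  shows "(\<Sum>s\<in>B. centered_indicator B r s) = 0"
  using assms by (simp add: centered_indicator_def sum_subtractf)

lemma abs_centered_indicator_le:
  assumes "finite B" "B \<noteq> {}"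
  shows "\<bar>centered_indicator B r s\<bar> \<le> 1"
proof -
  have "1 / real (card B) \<le> 1" "0 \<le> 1 / real (card B)"
    using assms card_gt_0_iff[of B] by (auto simp: divide_le_eq)
  then show ?thesis unfolding centered_indicator_def by (cases "s = r") (simp_all add: abs_if)
qed

text \<open>As a function of s the inner sum is \<phi> minus its mean, and subtracting the mean is
  an orthogonal projection. That no constant is lost here matters for the threshold.\<close>

lemma sum_square_centered_indicator_le:
  assumes B: "finite B" "B \<noteq> {}"
  shows "(\<Sum>s\<in>B. (\<Sum>r\<in>B. \<phi> r * centered_indicator B r s)\<^sup>2) \<le> (\<Sum>r\<in>B. (\<phi> r)\<^sup>2)"
proof -
  define m where "m = (\<Sum>r\<in>B. \<phi> r) / real (card B)"
  have k: "real (card B) > 0" using B by (simp add: card_gt_0_iff)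
  have "(\<Sum>r\<in>B. \<phi> r * centered_indicator B r s) = \<phi> s - m" if "s \<in> B" for s
  proof -
    have "(\<Sum>r\<in>B. \<phi> r * centered_indicator B r s) =
        (\<Sum>r\<in>B. if s = r then \<phi> r else 0) - (\<Sum>r\<in>B. \<phi> r / real (card B))"
      unfolding centered_indicator_def sum_subtractf[symmetric]
      by (intro sum.cong refl) (simp add: algebra_simps)
    then show ?thesis using that B by (simp add: m_def sum_divide_distrib)
  qed
  then have "(\<Sum>s\<in>B. (\<Sum>r\<in>B. \<phi> r * centered_indicator B r s)\<^sup>2) = (\<Sum>s\<in>B. (\<phi> s - m)\<^sup>2)"
    by simp
  also have "\<dots> = (\<Sum>s\<in>B. (\<phi> s)\<^sup>2) - 2 * m * (\<Sum>s\<in>B. \<phi> s) + real (card B) * m\<^sup>2"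
    unfolding power2_diff sum.distrib sum_subtractf sum_distrib_left by (simp add: mult_ac)
  also have "(\<Sum>s\<in>B. \<phi> s) = real (card B) * m" using k by (simp add: m_def)
  finally have "(\<Sum>s\<in>B. (\<Sum>r\<in>B. \<phi> r * centered_indicator B r s)\<^sup>2) =
      (\<Sum>s\<in>B. (\<phi> s)\<^sup>2) - real (card B) * m\<^sup>2" by (simp add: power2_eq_square)
  then show ?thesis using k by simp
qed

text \<open>An entry of the contingency table of the two labellings, with both indicators centered
  at their uniform mean.\<close>

definition cell_sum :: "'v set \<Rightarrow> nat set \<Rightarrow> ('v \<Rightarrow> nat) \<Rightarrow> ('v \<Rightarrow> nat) \<Rightarrow> nat \<times> nat \<Rightarrow> real" where
  "cell_sum A B \<sigma> \<tau> c =
    (\<Sum>a\<in>A. centered_indicator B (fst c) (\<sigma> a) * centered_indicator B (snd c) (\<tau> a))"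

text \<open>The exponent is a bounded form with sum 0 and sum of squares at most that of \<theta>,
  so the quadratic bound on exp applies. The condition on \<theta> bounds the form by
  \<open>r\<close>: there are (card B)^2 cells, each with a product of indicators of absolute value
  at most 1.\<close>

lemma single_site_mgf:
  fixes \<theta> :: "nat \<times> nat \<Rightarrow> real"
  assumes B: "finite B" "B \<noteq> {}" and \<theta>: "\<And>c. c \<in> B \<times> B \<Longrightarrow> \<bar>\<theta> c\<bar> \<le> r / (real (card B))\<^sup>2"
  shows "(\<Sum>s\<in>B. \<Sum>t\<in>B. exp (\<Sum>c\<in>B\<times>B. \<theta> c * (centered_indicator B (fst c) s * centered_indicator B (snd c) t)))
    \<le> (real (card B))\<^sup>2 * exp (exp r / (real (card B))\<^sup>2 * (\<Sum>c\<in>B\<times>B. (\<theta> c)\<^sup>2) / 2)"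
proof -
  define u where "u = centered_indicator B"
  define k where "k = real (card B)"
  have k: "k > 0" using B by (simp add: k_def card_gt_0_iff)
  define L where "L s t = (\<Sum>c\<in>B\<times>B. \<theta> c * (u (fst c) s * u (snd c) t))" for s t
  have abs_L: "\<bar>L s t\<bar> \<le> r" for s t
  proof -
    have "\<bar>L s t\<bar> \<le> (\<Sum>c\<in>B\<times>B. \<bar>\<theta> c * (u (fst c) s * u (snd c) t)\<bar>)"
      unfolding L_def by (rule sum_abs)
    also have "\<dots> \<le> (\<Sum>c\<in>B\<times>B. r / k\<^sup>2)"
    proof (rule sum_mono)
      fix c assume c: "c \<in> B \<times> B"
      have "\<bar>u (fst c) s\<bar> * \<bar>u (snd c) t\<bar> \<le> 1"
        unfolding u_def by (intro mult_le_one abs_centered_indicator_le B) auto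
      then have "\<bar>\<theta> c\<bar> * (\<bar>u (fst c) s\<bar> * \<bar>u (snd c) t\<bar>) \<le> \<bar>\<theta> c\<bar> * 1"
        by (intro mult_left_mono) auto
      also have "\<dots> \<le> r / k\<^sup>2" using \<theta>[OF c] by (simp add: k_def)
      finally show "\<bar>\<theta> c * (u (fst c) s * u (snd c) t)\<bar> \<le> r / k\<^sup>2" by (simp add: abs_mult)
    qed
    also have "\<dots> = r" using k by (simp add: k_def card_cartesian_product power2_eq_square)
    finally show ?thesis .
  qed
  have L_alt: "L s t = (\<Sum>b\<in>B. (\<Sum>a\<in>B. \<theta> (a, b) * u a s) * u b t)" for s t
    unfolding L_def sum_distrib_right by (subst sum.swap) (simp add: sum.cartesian_product split_beta mult_ac)
  have mean: "(\<Sum>s\<in>B. \<Sum>t\<in>B. L s t) = 0"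
  proof (rule sum.neutral, rule ballI)
    fix s
    have "(\<Sum>t\<in>B. L s t) = (\<Sum>b\<in>B. \<Sum>t\<in>B. (\<Sum>a\<in>B. \<theta> (a, b) * u a s) * u b t)"
      unfolding L_alt by (rule sum.swap)
    also have "\<dots> = 0"
      unfolding sum_distrib_left[symmetric] u_def by (simp add: sum_centered_indicator[OF B])
    finally show "(\<Sum>t\<in>B. L s t) = 0" .
  qed
  \<comment> \<open>The projection bound is used twice, first in the label of the second replica and
    then in that of the first.\<close>
  have var: "(\<Sum>s\<in>B. \<Sum>t\<in>B. (L s t)\<^sup>2) \<le> (\<Sum>c\<in>B\<times>B. (\<theta> c)\<^sup>2)"
  proof -
    have "(\<Sum>s\<in>B. \<Sum>t\<in>B. (L s t)\<^sup>2) \<le> (\<Sum>s\<in>B. \<Sum>b\<in>B. (\<Sum>a\<in>B. \<theta> (a, b) * u a s)\<^sup>2)"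
      unfolding L_alt u_def by (intro sum_mono sum_square_centered_indicator_le B)
    also have "\<dots> = (\<Sum>b\<in>B. \<Sum>s\<in>B. (\<Sum>a\<in>B. \<theta> (a, b) * u a s)\<^sup>2)" by (rule sum.swap)
    also have "\<dots> \<le> (\<Sum>b\<in>B. \<Sum>a\<in>B. (\<theta> (a, b))\<^sup>2)"
      unfolding u_def by (intro sum_mono sum_square_centered_indicator_le B)
    also have "\<dots> = (\<Sum>c\<in>B\<times>B. (\<theta> c)\<^sup>2)"
      by (subst sum.swap) (simp add: sum.cartesian_product)
    finally show ?thesis .
  qed
  have "(\<Sum>s\<in>B. \<Sum>t\<in>B. exp (L s t)) \<le> (\<Sum>s\<in>B. \<Sum>t\<in>B. 1 + L s t + exp r / 2 * (L s t)\<^sup>2)"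
    using exp_le_quadratic[OF abs_L] by (intro sum_mono) simp
  also have "\<dots> = k\<^sup>2 + exp r / 2 * (\<Sum>s\<in>B. \<Sum>t\<in>B. (L s t)\<^sup>2)"
    unfolding sum.distrib mean sum_distrib_left[symmetric] by (simp add: k_def power2_eq_square)
  also have "\<dots> \<le> k\<^sup>2 + exp r / 2 * (\<Sum>c\<in>B\<times>B. (\<theta> c)\<^sup>2)"
    by (intro add_left_mono mult_left_mono var) simp
  also have "\<dots> = k\<^sup>2 * (1 + exp r / k\<^sup>2 * (\<Sum>c\<in>B\<times>B. (\<theta> c)\<^sup>2) / 2)"
    using k by (simp add: field_simps)
  also have "\<dots> \<le> k\<^sup>2 * exp (exp r / k\<^sup>2 * (\<Sum>c\<in>B\<times>B. (\<theta> c)\<^sup>2) / 2)"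
    by (intro mult_left_mono) (auto intro: exp_ge_add_one_self)
  finally show ?thesis by (simp add: L_def u_def k_def)
qed

text \<open>The exponential of a linear form in the cell sums factors over the vertices, and so does
  the sum over all pairs of labellings.\<close>

lemma cell_sum_mgf:
  fixes \<theta> :: "nat \<times> nat \<Rightarrow> real" and A :: "'v set"
  assumes A: "finite A" and B: "finite B" "B \<noteq> {}"
    and \<theta>: "\<And>c. c \<in> B \<times> B \<Longrightarrow> \<bar>\<theta> c\<bar> \<le> r / (real (card B))\<^sup>2"
  shows "(\<Sum>\<sigma>\<in>A \<rightarrow>\<^sub>E B. \<Sum>\<tau>\<in>A \<rightarrow>\<^sub>E B. exp (\<Sum>c\<in>B\<times>B. \<theta> c * cell_sum A B \<sigma> \<tau> c))
    \<le> (real (card (A \<rightarrow>\<^sub>E B)))\<^sup>2 *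
      exp (real (card A) * exp r / (real (card B))\<^sup>2 * (\<Sum>c\<in>B\<times>B. (\<theta> c)\<^sup>2) / 2)"
proof -
  define h where "h s t = exp (\<Sum>c\<in>B\<times>B. \<theta> c * (centered_indicator B (fst c) s * centered_indicator B (snd c) t))" for s t
  have "exp (\<Sum>c\<in>B\<times>B. \<theta> c * cell_sum A B \<sigma> \<tau> c) = (\<Prod>a\<in>A. h (\<sigma> a) (\<tau> a))" for \<sigma> \<tau>
    unfolding h_def exp_sum[OF A, symmetric] cell_sum_def sum_distrib_left
    by (subst sum.swap) (rule refl)
  then have "(\<Sum>\<sigma>\<in>A \<rightarrow>\<^sub>E B. \<Sum>\<tau>\<in>A \<rightarrow>\<^sub>E B. exp (\<Sum>c\<in>B\<times>B. \<theta> c * cell_sum A B \<sigma> \<tau> c)) =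
      (\<Sum>\<sigma>\<in>A \<rightarrow>\<^sub>E B. \<Sum>\<tau>\<in>A \<rightarrow>\<^sub>E B. \<Prod>a\<in>A. h (\<sigma> a) (\<tau> a))" by simp
  also have "\<dots> = (\<Sum>\<sigma>\<in>A \<rightarrow>\<^sub>E B. \<Prod>a\<in>A. \<Sum>t\<in>B. h (\<sigma> a) t)"
    using A B by (intro sum.cong refl prod_sum_PiE[symmetric]) auto
  also have "\<dots> = (\<Prod>a\<in>A. \<Sum>s\<in>B. \<Sum>t\<in>B. h s t)"
    using A B by (intro prod_sum_PiE[symmetric]) auto
  also have "\<dots> = (\<Sum>s\<in>B. \<Sum>t\<in>B. h s t) ^ card A" by simp
  also have "\<dots> \<le> ((real (card B))\<^sup>2 * exp (exp r / (real (card B))\<^sup>2 * (\<Sum>c\<in>B\<times>B. (\<theta> c)\<^sup>2) / 2)) ^ card A"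
    unfolding h_def by (intro power_mono single_site_mgf B \<theta> sum_nonneg) auto
  also have "\<dots> = (real (card (A \<rightarrow>\<^sub>E B)))\<^sup>2 *
      exp (real (card A) * exp r / (real (card B))\<^sup>2 * (\<Sum>c\<in>B\<times>B. (\<theta> c)\<^sup>2) / 2)"
    using A by (simp add: power_mult_distrib card_PiE exp_of_nat_mult[symmetric] power_mult[symmetric] mult_ac)
  finally show ?thesis .
qed

lemma sum_rotate:
  "(\<Sum>a\<in>A. \<Sum>b\<in>B. \<Sum>c\<in>C. f a b c) = (\<Sum>c\<in>C. \<Sum>a\<in>A. \<Sum>b\<in>B. f a b c)"
proof -
  have "(\<Sum>a\<in>A. \<Sum>b\<in>B. \<Sum>c\<in>C. f a b c) = (\<Sum>a\<in>A. \<Sum>c\<in>C. \<Sum>b\<in>B. f a b c)"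
    by (intro sum.cong refl sum.swap)
  also have "\<dots> = (\<Sum>c\<in>C. \<Sum>a\<in>A. \<Sum>b\<in>B. f a b c)"
    by (rule sum.swap)
  finally show ?thesis .
qed

text \<open>cosh is the mean of exp over a random sign; expanding the product puts one sign on each
  index.\<close>

lemma prod_cosh:
  fixes z :: "'c \<Rightarrow> real"
  assumes "finite C"
  shows "(\<Prod>c\<in>C. cosh (z c)) = (\<Sum>\<epsilon>\<in>C \<rightarrow>\<^sub>E {1, -1}. exp (\<Sum>c\<in>C. \<epsilon> c * z c)) / 2 ^ card C"
proof -
  have "(\<Prod>c\<in>C. cosh (z c)) = (\<Prod>c\<in>C. (\<Sum>\<epsilon>\<in>{1, -1}. exp (\<epsilon> * z c)) / 2)"
    by (simp add: cosh_def)
  also have "\<dots> = (\<Prod>c\<in>C. \<Sum>\<epsilon>\<in>{1, -1}. exp (\<epsilon> * z c)) / 2 ^ card C"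
    by (simp add: prod_dividef)
  also have "(\<Prod>c\<in>C. \<Sum>\<epsilon>\<in>{1, -1}. exp (\<epsilon> * z c)) =
      (\<Sum>\<epsilon>\<in>C \<rightarrow>\<^sub>E {1, -1}. \<Prod>c\<in>C. exp (\<epsilon> c * z c))"
    using assms by (intro prod_sum_PiE) auto
  finally show ?thesis using assms by (simp add: exp_sum)
qed

text \<open>Each choice of signs gives a linear form whose generating function is bounded through
  the squared coefficients only, so all choices share one bound.\<close>

lemma cell_sum_prod_cosh:
  fixes s :: "nat \<times> nat \<Rightarrow> real" and A :: "'v set"
  assumes A: "finite A" and B: "finite B" "B \<noteq> {}"
    and s: "\<And>c. c \<in> B \<times> B \<Longrightarrow> \<bar>s c\<bar> \<le> r / (real (card B))\<^sup>2"
  shows "(\<Sum>\<sigma>\<in>A \<rightarrow>\<^sub>E B. \<Sum>\<tau>\<in>A \<rightarrow>\<^sub>E B. \<Prod>c\<in>B\<times>B. cosh (s c * cell_sum A B \<sigma> \<tau> c))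
    \<le> (real (card (A \<rightarrow>\<^sub>E B)))\<^sup>2 *
      exp (real (card A) * exp r / (real (card B))\<^sup>2 * (\<Sum>c\<in>B\<times>B. (s c)\<^sup>2) / 2)" (is "_ \<le> ?R")
proof -
  let ?C = "B \<times> B" and ?S = "(B \<times> B) \<rightarrow>\<^sub>E {1, -1 :: real}"
  have "(\<Sum>\<sigma>\<in>A \<rightarrow>\<^sub>E B. \<Sum>\<tau>\<in>A \<rightarrow>\<^sub>E B. \<Prod>c\<in>?C. cosh (s c * cell_sum A B \<sigma> \<tau> c)) =
      (\<Sum>\<sigma>\<in>A \<rightarrow>\<^sub>E B. \<Sum>\<tau>\<in>A \<rightarrow>\<^sub>E B. \<Sum>\<epsilon>\<in>?S. exp (\<Sum>c\<in>?C. (\<epsilon> c * s c) * cell_sum A B \<sigma> \<tau> c)) / 2 ^ card ?C"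
    using B by (subst prod_cosh) (auto simp: sum_divide_distrib mult.assoc)
  also have "(\<Sum>\<sigma>\<in>A \<rightarrow>\<^sub>E B. \<Sum>\<tau>\<in>A \<rightarrow>\<^sub>E B. \<Sum>\<epsilon>\<in>?S. exp (\<Sum>c\<in>?C. (\<epsilon> c * s c) * cell_sum A B \<sigma> \<tau> c)) =
      (\<Sum>\<epsilon>\<in>?S. \<Sum>\<sigma>\<in>A \<rightarrow>\<^sub>E B. \<Sum>\<tau>\<in>A \<rightarrow>\<^sub>E B. exp (\<Sum>c\<in>?C. (\<epsilon> c * s c) * cell_sum A B \<sigma> \<tau> c))"
    by (rule sum_rotate)
  also have "\<dots> \<le> (\<Sum>\<epsilon>\<in>?S. ?R)"
  proof (rule sum_mono)
    fix \<epsilon> assume \<epsilon>: "\<epsilon> \<in> ?S"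
    have \<epsilon>1: "\<epsilon> c = 1 \<or> \<epsilon> c = -1" if "c \<in> ?C" for c
      using \<epsilon> that by (auto simp: PiE_def Pi_def)
    have "(\<Sum>\<sigma>\<in>A \<rightarrow>\<^sub>E B. \<Sum>\<tau>\<in>A \<rightarrow>\<^sub>E B. exp (\<Sum>c\<in>?C. (\<epsilon> c * s c) * cell_sum A B \<sigma> \<tau> c)) \<le>
        (real (card (A \<rightarrow>\<^sub>E B)))\<^sup>2 *
        exp (real (card A) * exp r / (real (card B))\<^sup>2 * (\<Sum>c\<in>?C. (\<epsilon> c * s c)\<^sup>2) / 2)"
    proof (rule cell_sum_mgf[OF A B])
      fix c assume "c \<in> ?C"
      then show "\<bar>\<epsilon> c * s c\<bar> \<le> r / (real (card B))\<^sup>2" using \<epsilon>1[of c] s[of c] by (auto simp: abs_mult)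
    qed
    also have "(\<Sum>c\<in>?C. (\<epsilon> c * s c)\<^sup>2) = (\<Sum>c\<in>?C. (s c)\<^sup>2)"
      by (rule sum.cong[OF refl]) (use \<epsilon>1 in \<open>force simp: power_mult_distrib\<close>)
    finally show "(\<Sum>\<sigma>\<in>A \<rightarrow>\<^sub>E B. \<Sum>\<tau>\<in>A \<rightarrow>\<^sub>E B. exp (\<Sum>c\<in>?C. (\<epsilon> c * s c) * cell_sum A B \<sigma> \<tau> c)) \<le> ?R" .
  qed
  also have "\<dots> = 2 ^ card ?C * ?R"
    using B by (simp add: card_PiE)
  finally show ?thesis by (simp add: divide_right_mono)
qed

text \<open>\<kappa> is the variance proxy of a cell sum, and \<mu>\<kappa> <= 1 is the
  Kesten--Stigum condition with room for the factor exp r. The condition on \<open>r\<close> keeps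
  the Chernoff parameters of all orders up to \<open>D\<close> where the generating function is
  controlled.\<close>

lemma cell_sum_truncated_exp:
  fixes A :: "'v set" and \<mu> r :: real
  assumes A: "finite A" "A \<noteq> {}" and B: "finite B" "B \<noteq> {}"
    and \<kappa>: "\<kappa> = real (card A) * exp r / (real (card B))\<^sup>2"
    and \<mu>: "0 \<le> \<mu>" "\<mu> * \<kappa> \<le> 1"
    and r: "sqrt (2 * real D / \<kappa>) \<le> r / (real (card B))\<^sup>2"
  shows "(\<Sum>\<sigma>\<in>A \<rightarrow>\<^sub>E B. \<Sum>\<tau>\<in>A \<rightarrow>\<^sub>E B. truncated_exp D (\<mu> / 2 * (\<Sum>c\<in>B\<times>B. (cell_sum A B \<sigma> \<tau> c)\<^sup>2)))
    \<le> (real (card (A \<rightarrow>\<^sub>E B)))\<^sup>2 * (exp 1 * (real (D + 1))\<^sup>2) ^ (card B)\<^sup>2"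
proof -
  let ?C = "B \<times> B"
  let ?L = "(B \<times> B) \<rightarrow>\<^sub>E {..D}"
  define \<Omega> where "\<Omega> = A \<rightarrow>\<^sub>E B"
  define K where "K = (real (card \<Omega>))\<^sup>2"
  have kB: "real (card B) > 0" using B by (simp add: card_gt_0_iff)
  have kA: "real (card A) > 0" using A by (simp add: card_gt_0_iff)
  have \<kappa>0: "\<kappa> > 0" using kA kB unfolding \<kappa> by (intro divide_pos_pos mult_pos_pos) auto
  define X where "X = cell_sum A B"
  define s where "s l = sqrt (2 * real l / \<kappa>)" for l :: nat
  define w where "w l = exp 1 * real (l + 1) * exp (- real l)" for l :: nat
  have w0: "0 \<le> w l" for l by (simp add: w_def)
  \<comment> \<open>Each cell gets its own moment order; expanding the product of sums gives a sum
    over assignments \<open>l\<close> of orders to cells.\<close>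
  have pointwise: "truncated_exp D (\<mu> / 2 * (\<Sum>c\<in>?C. (X \<sigma> \<tau> c)\<^sup>2)) \<le>
      (\<Sum>l\<in>?L. (\<Prod>c\<in>?C. w (l c)) * (\<Prod>c\<in>?C. cosh (s (l c) * X \<sigma> \<tau> c)))" for \<sigma> \<tau>
  proof -
    have "truncated_exp D (\<mu> / 2 * (\<Sum>c\<in>?C. (X \<sigma> \<tau> c)\<^sup>2)) =
        truncated_exp D (\<Sum>c\<in>?C. \<mu> * (X \<sigma> \<tau> c)\<^sup>2 / 2)"
      by (simp add: sum_distrib_left)
    also have "\<dots> \<le> (\<Prod>c\<in>?C. truncated_exp D (\<mu> * (X \<sigma> \<tau> c)\<^sup>2 / 2))"
      using B \<mu> by (intro truncated_exp_sum) auto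
    also have "\<dots> \<le> (\<Prod>c\<in>?C. \<Sum>l\<le>D. w l * cosh (s l * X \<sigma> \<tau> c))"
      unfolding truncated_exp_def w_def s_def using \<mu>
      by (intro prod_mono conjI sum_mono sum_nonneg power_le_scaled_cosh \<kappa>0) auto
    also have "\<dots> = (\<Sum>l\<in>?L. \<Prod>c\<in>?C. w (l c) * cosh (s (l c) * X \<sigma> \<tau> c))"
      using B by (intro prod_sum_PiE) auto
    finally show ?thesis by (simp add: prod.distrib)
  qed
  have "(\<Sum>\<sigma>\<in>\<Omega>. \<Sum>\<tau>\<in>\<Omega>. truncated_exp D (\<mu> / 2 * (\<Sum>c\<in>?C. (X \<sigma> \<tau> c)\<^sup>2))) \<le>
      (\<Sum>\<sigma>\<in>\<Omega>. \<Sum>\<tau>\<in>\<Omega>. \<Sum>l\<in>?L. (\<Prod>c\<in>?C. w (l c)) * (\<Prod>c\<in>?C. cosh (s (l c) * X \<sigma> \<tau> c)))"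
    by (intro sum_mono pointwise)
  also have "\<dots> = (\<Sum>l\<in>?L. \<Sum>\<sigma>\<in>\<Omega>. \<Sum>\<tau>\<in>\<Omega>. (\<Prod>c\<in>?C. w (l c)) * (\<Prod>c\<in>?C. cosh (s (l c) * X \<sigma> \<tau> c)))"
    by (rule sum_rotate)
  also have "\<dots> = (\<Sum>l\<in>?L. (\<Prod>c\<in>?C. w (l c)) * (\<Sum>\<sigma>\<in>\<Omega>. \<Sum>\<tau>\<in>\<Omega>. \<Prod>c\<in>?C. cosh (s (l c) * X \<sigma> \<tau> c)))"
    by (simp add: sum_distrib_left)
  also have "\<dots> \<le> (\<Sum>l\<in>?L. K * (exp 1 * real (D + 1)) ^ card ?C)"
  proof (rule sum_mono)
    fix l assume l: "l \<in> ?L"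
    then have lD: "l c \<le> D" if "c \<in> ?C" for c using that by (auto simp: PiE_def Pi_def)
    have "(\<Sum>\<sigma>\<in>\<Omega>. \<Sum>\<tau>\<in>\<Omega>. \<Prod>c\<in>?C. cosh (s (l c) * X \<sigma> \<tau> c)) \<le>
        K * exp (real (card A) * exp r / (real (card B))\<^sup>2 * (\<Sum>c\<in>?C. (s (l c))\<^sup>2) / 2)"
      unfolding \<Omega>_def X_def K_def
    proof (rule cell_sum_prod_cosh[OF A(1) B])
      fix c assume c: "c \<in> ?C"
      have "\<bar>s (l c)\<bar> \<le> sqrt (2 * real D / \<kappa>)"
        using lD[OF c] \<kappa>0 by (auto simp: s_def intro!: divide_right_mono)
      also note r
      finally show "\<bar>s (l c)\<bar> \<le> r / (real (card B))\<^sup>2" .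
    qed
    \<comment> \<open>The choice of \<open>s\<close> makes the exponent the sum of the orders, which
      cancels the factors exp(-l) in \<open>w\<close>.\<close>
    also have "real (card A) * exp r / (real (card B))\<^sup>2 * (\<Sum>c\<in>?C. (s (l c))\<^sup>2) / 2 = (\<Sum>c\<in>?C. real (l c))"
      unfolding \<kappa>[symmetric] using \<kappa>0 by (simp add: s_def sum_distrib_left sum_divide_distrib)
    finally have "(\<Prod>c\<in>?C. w (l c)) * (\<Sum>\<sigma>\<in>\<Omega>. \<Sum>\<tau>\<in>\<Omega>. \<Prod>c\<in>?C. cosh (s (l c) * X \<sigma> \<tau> c)) \<le>
        (\<Prod>c\<in>?C. w (l c)) * (K * exp (\<Sum>c\<in>?C. real (l c)))"
      by (intro mult_left_mono prod_nonneg) (auto simp: w0)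
    also have "\<dots> = K * (\<Prod>c\<in>?C. w (l c) * exp (real (l c)))"
      using B by (simp add: exp_sum prod.distrib)
    also have "\<dots> = K * (\<Prod>c\<in>?C. exp 1 * real (l c + 1))"
      by (simp add: w_def mult.assoc mult_exp_exp)
    also have "\<dots> \<le> K * (\<Prod>c\<in>?C. exp 1 * real (D + 1))"
      using lD by (intro mult_left_mono prod_mono) (auto simp: K_def)
    finally show "(\<Prod>c\<in>?C. w (l c)) * (\<Sum>\<sigma>\<in>\<Omega>. \<Sum>\<tau>\<in>\<Omega>. \<Prod>c\<in>?C. cosh (s (l c) * X \<sigma> \<tau> c)) \<le>
        K * (exp 1 * real (D + 1)) ^ card ?C" by simp
  qed
  \<comment> \<open>The second factor D+1 per cell counts the assignments of orders.\<close>
  also have "\<dots> = K * (exp 1 * (real (D + 1))\<^sup>2) ^ card ?C"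
    using B by (simp add: card_PiE power_mult_distrib power2_eq_square)
  also have "card ?C = (card B)\<^sup>2" by (simp add: card_cartesian_product power2_eq_square)
  finally show ?thesis by (simp add: \<Omega>_def X_def K_def)
qed

subsection \<open>Overlaps of two labellings\<close>

text \<open>Up to the factor \<epsilon>d/n this is the deviation of the edge probability from d/n;
  at the pair i, j it is the quantity to be estimated.\<close>

definition agreement :: "nat set \<Rightarrow> nat \<Rightarrow> nat \<Rightarrow> real" where
  "agreement B s t = of_bool (s = t) - 1 / real (card B)"

lemma agreement_sym: "agreement B s t = agreement B t s"
  by (auto simp: agreement_def)

text \<open>An inner product of centered label vectors; this form makes the total overlap a sum of
  squares.\<close>

lemma agreement_eq_sum:
  assumes B: "finite B" "s \<in> B" "t \<in> B"
  shows "agreement B s t = (\<Sum>r\<in>B. centered_indicator B r s * centered_indicator B r t)"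
proof -
  have k: "real (card B) > 0" using B by (auto simp: card_gt_0_iff)
  have "(\<Sum>r\<in>B. centered_indicator B r s * centered_indicator B r t) =
      (\<Sum>r\<in>B. (if r = s then of_bool (s = t) else 0) - (if r = s then 1 / real (card B) else 0)
        - (if r = t then 1 / real (card B) else 0) + 1 / (real (card B))\<^sup>2)"
    by (intro sum.cong) (auto simp: centered_indicator_def algebra_simps power2_eq_square)
  also have "\<dots> = of_bool (s = t) - 1 / real (card B) - 1 / real (card B) + real (card B) * (1 / (real (card B))\<^sup>2)"
    unfolding sum.distrib sum_subtractf using B by simp
  also have "\<dots> = agreement B s t" using k by (simp add: agreement_def power2_eq_square)
  finally show ?thesis by simp
qed

definition overlap :: "nat set \<Rightarrow> 'v \<Rightarrow> 'v \<Rightarrow> ('v \<Rightarrow> nat) \<Rightarrow> ('v \<Rightarrow> nat) \<Rightarrow> real" where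
  "overlap B a b \<sigma> \<tau> = agreement B (\<sigma> a) (\<sigma> b) * agreement B (\<tau> a) (\<tau> b)"

text \<open>The diagonal and both orders of each pair are included: the full double sum is a sum of
  squares, whereas the sum over edges can be negative.\<close>

definition total_overlap :: "'v set \<Rightarrow> nat set \<Rightarrow> ('v \<Rightarrow> nat) \<Rightarrow> ('v \<Rightarrow> nat) \<Rightarrow> real" where
  "total_overlap A B \<sigma> \<tau> = (\<Sum>a\<in>A. \<Sum>b\<in>A. overlap B a b \<sigma> \<tau>)"

lemma replica_pos_overlap: "replica_pos (overlap B a b)"
  unfolding overlap_def by (rule replica_pos.rank1)

lemma overlap_sym: "overlap B a b = overlap B b a"
  unfolding overlap_def by (intro ext arg_cong2[where f = "(*)"] agreement_sym)

lemma overlap_diag_nonneg: "0 \<le> overlap B a a \<sigma> \<tau>"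
  by (simp add: overlap_def agreement_def)

lemma total_overlap_eq_cell_sums:
  assumes B: "finite B" and \<sigma>: "\<sigma> \<in> A \<rightarrow>\<^sub>E B" and \<tau>: "\<tau> \<in> A \<rightarrow>\<^sub>E B"
  shows "total_overlap A B \<sigma> \<tau> = (\<Sum>c\<in>B\<times>B. (cell_sum A B \<sigma> \<tau> c)\<^sup>2)"
proof -
  let ?u = "centered_indicator B"
  have "(\<Sum>c\<in>B\<times>B. (cell_sum A B \<sigma> \<tau> c)\<^sup>2) = (\<Sum>c\<in>B\<times>B. \<Sum>a\<in>A. \<Sum>b\<in>A.
      (?u (fst c) (\<sigma> a) * ?u (fst c) (\<sigma> b)) * (?u (snd c) (\<tau> a) * ?u (snd c) (\<tau> b)))"
    unfolding cell_sum_def power2_eq_square sum_product by (simp add: mult_ac)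
  also have "\<dots> = (\<Sum>a\<in>A. \<Sum>b\<in>A. \<Sum>c\<in>B\<times>B.
      (?u (fst c) (\<sigma> a) * ?u (fst c) (\<sigma> b)) * (?u (snd c) (\<tau> a) * ?u (snd c) (\<tau> b)))"
    by (rule sum_rotate[symmetric])
  also have "\<dots> = total_overlap A B \<sigma> \<tau>"
    unfolding total_overlap_def
  proof (intro sum.cong refl)
    fix a b assume "a \<in> A" "b \<in> A"
    then have m: "\<sigma> a \<in> B" "\<sigma> b \<in> B" "\<tau> a \<in> B" "\<tau> b \<in> B" using \<sigma> \<tau> by auto
    show "(\<Sum>c\<in>B\<times>B. (?u (fst c) (\<sigma> a) * ?u (fst c) (\<sigma> b)) * (?u (snd c) (\<tau> a) * ?u (snd c) (\<tau> b)))
        = overlap B a b \<sigma> \<tau>"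
      unfolding overlap_def agreement_eq_sum[OF B m(1,2)] agreement_eq_sum[OF B m(3,4)] sum_product
      by (simp add: sum.cartesian_product split_beta)
  qed
  finally show ?thesis by simp
qed

lemma sum_pairs_eq_vertex_pairs:
  fixes g :: "nat \<Rightarrow> nat \<Rightarrow> real"
  assumes "\<And>a b. g a b = g b a"
  shows "(\<Sum>a\<in>{1..n}. \<Sum>b\<in>{1..n}. g a b) =
    (\<Sum>a\<in>{1..n}. g a a) + 2 * (\<Sum>e\<in>vertex_pairs n. g (fst e) (snd e))"
proof -
  let ?V = "vertex_pairs n" and ?D = "(\<lambda>a. (a, a)) ` {1..n}"
  have eq: "{1..n} \<times> {1..n} = ?D \<union> (?V \<union> prod.swap ` ?V)"
    by (auto simp: vertex_pairs_def image_iff)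
  have disj: "?D \<inter> (?V \<union> prod.swap ` ?V) = {}" "?V \<inter> prod.swap ` ?V = {}"
    by (auto simp: vertex_pairs_def)
  have "(\<Sum>a\<in>{1..n}. \<Sum>b\<in>{1..n}. g a b) = (\<Sum>e\<in>{1..n} \<times> {1..n}. g (fst e) (snd e))"
    by (simp add: sum.cartesian_product split_beta)
  also have "\<dots> = (\<Sum>e\<in>?D. g (fst e) (snd e)) + ((\<Sum>e\<in>?V. g (fst e) (snd e)) +
      (\<Sum>e\<in>prod.swap ` ?V. g (fst e) (snd e)))"
    unfolding eq using disj by (simp add: sum.union_disjoint finite_vertex_pairs)
  also have "(\<Sum>e\<in>?D. g (fst e) (snd e)) = (\<Sum>a\<in>{1..n}. g a a)"
    by (subst sum.reindex) (auto simp: inj_on_def)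
  also have "(\<Sum>e\<in>prod.swap ` ?V. g (fst e) (snd e)) = (\<Sum>e\<in>?V. g (snd e) (fst e))"
    by (subst sum.reindex) auto
  also have "\<dots> = (\<Sum>e\<in>?V. g (fst e) (snd e))" using assms by (intro sum.cong) auto
  finally show ?thesis by simp
qed

text \<open>Half of the total overlap exceeds the edge sum by half the diagonal, which lies in the
  cone. Passing to the full sum is therefore an increase in the replica order, also after taking
  powers.\<close>

lemma elementary_overlap_replica_le:
  "replica_le (\<lambda>\<sigma> \<tau>. \<Sum>R | R \<subseteq> vertex_pairs n \<and> card R = l. \<Prod>e\<in>R. overlap B (fst e) (snd e) \<sigma> \<tau>)
    (\<lambda>\<sigma> \<tau>. (total_overlap {1..n} B \<sigma> \<tau> / 2) ^ l / fact l)"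
proof -
  let ?e = "\<lambda>\<sigma> \<tau>. \<Sum>R | R \<subseteq> vertex_pairs n \<and> card R = l. \<Prod>e\<in>R. overlap B (fst e) (snd e) \<sigma> \<tau>"
  let ?Y = "\<lambda>\<sigma> \<tau>. \<Sum>e\<in>vertex_pairs n. overlap B (fst e) (snd e) \<sigma> \<tau>"
  let ?Q = "\<lambda>\<sigma> \<tau>. total_overlap {1..n} B \<sigma> \<tau> / 2"
  have Y: "replica_pos ?Y" by (intro replica_pos_sum replica_pos_overlap)
  have Q: "replica_pos ?Q"
    unfolding total_overlap_def divide_inverse
    by (intro replica_pos_mult replica_pos_sum replica_pos_overlap replica_pos_const) simp
  have diff: "?Q \<sigma> \<tau> - ?Y \<sigma> \<tau> = (\<Sum>a\<in>{1..n}. overlap B a a \<sigma> \<tau>) * (1 / 2)" for \<sigma> \<tau>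
  proof -
    have "total_overlap {1..n} B \<sigma> \<tau> = (\<Sum>a\<in>{1..n}. overlap B a a \<sigma> \<tau>) + 2 * ?Y \<sigma> \<tau>"
      unfolding total_overlap_def by (rule sum_pairs_eq_vertex_pairs) (subst overlap_sym, rule refl)
    then show ?thesis by linarith
  qed
  have "replica_le ?Y ?Q"
    unfolding replica_le_def diff
    by (intro replica_pos_mult replica_pos_sum replica_pos_overlap replica_pos_const) simp
  then have "replica_le (\<lambda>\<sigma> \<tau>. ?Y \<sigma> \<tau> ^ l) (\<lambda>\<sigma> \<tau>. ?Q \<sigma> \<tau> ^ l)"
    by (rule replica_le_power[OF Y Q])
  moreover have "replica_le (\<lambda>\<sigma> \<tau>. fact l * ?e \<sigma> \<tau>) (\<lambda>\<sigma> \<tau>. ?Y \<sigma> \<tau> ^ l)"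
    by (intro fact_elementary_symmetric_replica_le finite_vertex_pairs replica_pos_overlap)
  ultimately have "replica_le (\<lambda>\<sigma> \<tau>. fact l * ?e \<sigma> \<tau>) (\<lambda>\<sigma> \<tau>. ?Q \<sigma> \<tau> ^ l)"
    by (rule replica_le_trans[rotated])
  then have "replica_le (\<lambda>\<sigma> \<tau>. 1 / fact l * (fact l * ?e \<sigma> \<tau>)) (\<lambda>\<sigma> \<tau>. 1 / fact l * ?Q \<sigma> \<tau> ^ l)"
    by (intro replica_le_mult_left replica_pos_const) simp
  then show ?thesis by simp
qed

lemma sum_replica_le:
  assumes "replica_le f g"
  shows "(\<Sum>x\<in>A. \<Sum>y\<in>A. f x y) \<le> (\<Sum>x\<in>A. \<Sum>y\<in>A. g x y)"
  using sum_replica_pos_nonneg[of "\<lambda>x y. g x y - f x y" A] assms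
  by (simp add: replica_le_def sum_subtractf)

text \<open>Squaring a correlation gives a double sum over two replicas, and grouping edge sets by
  size produces elementary symmetric polynomials. The weight \<open>overlap B i j\<close> may be
  negative, so their replacement by powers is made in the replica order.\<close>

lemma sum_correlations_le:
  fixes \<mu> :: real
  assumes "0 \<le> \<mu>"
  shows "(\<Sum>R | R \<subseteq> vertex_pairs n \<and> card R \<le> D. \<mu> ^ card R *
      (\<Sum>\<sigma>\<in>\<Omega>. agreement B (\<sigma> i) (\<sigma> j) * (\<Prod>e\<in>R. agreement B (\<sigma> (fst e)) (\<sigma> (snd e))))\<^sup>2) \<le>
    (\<Sum>\<sigma>\<in>\<Omega>. \<Sum>\<tau>\<in>\<Omega>. overlap B i j \<sigma> \<tau> * truncated_exp D (\<mu> / 2 * total_overlap {1..n} B \<sigma> \<tau>))"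
proof -
  let ?V = "vertex_pairs n"
  define T where "T R = (\<Sum>\<sigma>\<in>\<Omega>. agreement B (\<sigma> i) (\<sigma> j) * (\<Prod>e\<in>R. agreement B (\<sigma> (fst e)) (\<sigma> (snd e))))" for R
  define el where "el l \<sigma> \<tau> = (\<Sum>R | R \<subseteq> ?V \<and> card R = l. \<Prod>e\<in>R. overlap B (fst e) (snd e) \<sigma> \<tau>)" for l \<sigma> \<tau>
  have T2: "(T R)\<^sup>2 = (\<Sum>\<sigma>\<in>\<Omega>. \<Sum>\<tau>\<in>\<Omega>. overlap B i j \<sigma> \<tau> * (\<Prod>e\<in>R. overlap B (fst e) (snd e) \<sigma> \<tau>))" for R
    unfolding T_def power2_eq_square sum_product by (simp add: overlap_def prod.distrib mult_ac)
  have "(\<Sum>R | R \<subseteq> ?V \<and> card R \<le> D. \<mu> ^ card R * (T R)\<^sup>2) =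
      (\<Sum>l\<le>D. \<Sum>R | R \<in> {R. R \<subseteq> ?V \<and> card R \<le> D} \<and> card R = l. \<mu> ^ card R * (T R)\<^sup>2)"
    by (rule sum.group[symmetric]) (auto simp: finite_vertex_pairs)
  also have "\<dots> = (\<Sum>l\<le>D. \<mu> ^ l * (\<Sum>R | R \<subseteq> ?V \<and> card R = l. (T R)\<^sup>2))"
    unfolding sum_distrib_left by (intro sum.cong refl) auto
  also have "\<dots> = (\<Sum>l\<le>D. \<mu> ^ l * (\<Sum>\<sigma>\<in>\<Omega>. \<Sum>\<tau>\<in>\<Omega>. overlap B i j \<sigma> \<tau> * el l \<sigma> \<tau>))"
    unfolding T2 el_def sum_distrib_left[of "overlap B i j _ _"] by (subst sum_rotate) (rule refl)
  also have "\<dots> \<le> (\<Sum>l\<le>D. \<mu> ^ l * (\<Sum>\<sigma>\<in>\<Omega>. \<Sum>\<tau>\<in>\<Omega>. overlap B i j \<sigma> \<tau> *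
      ((total_overlap {1..n} B \<sigma> \<tau> / 2) ^ l / fact l)))"
    unfolding el_def using assms
    by (intro sum_mono mult_left_mono sum_replica_le replica_le_mult_left replica_pos_overlap
        elementary_overlap_replica_le) auto
  also have "\<dots> = (\<Sum>l\<le>D. \<Sum>\<sigma>\<in>\<Omega>. \<Sum>\<tau>\<in>\<Omega>. overlap B i j \<sigma> \<tau> *
      ((\<mu> / 2 * total_overlap {1..n} B \<sigma> \<tau>) ^ l / fact l))"
    unfolding sum_distrib_left
    by (intro sum.cong refl) (simp add: power_mult_distrib power_divide)
  also have "\<dots> = (\<Sum>\<sigma>\<in>\<Omega>. \<Sum>\<tau>\<in>\<Omega>. overlap B i j \<sigma> \<tau> * truncated_exp D (\<mu> / 2 * total_overlap {1..n} B \<sigma> \<tau>))"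
    unfolding truncated_exp_def sum_distrib_left by (rule sum_rotate[symmetric])
  finally show ?thesis by (simp add: T_def)
qed

section \<open>Exchangeability of the vertices\<close>

lemma bij_betw_comp_permutes:
  assumes "\<pi> permutes A"
  shows "bij_betw (\<lambda>\<sigma>. \<sigma> \<circ> \<pi>) (A \<rightarrow>\<^sub>E B) (A \<rightarrow>\<^sub>E B)"
proof (rule bij_betwI[where g = "\<lambda>\<sigma>. \<sigma> \<circ> inv \<pi>"])
  have *: "\<sigma> \<circ> \<rho> \<in> A \<rightarrow>\<^sub>E B" if "\<rho> permutes A" "\<sigma> \<in> A \<rightarrow>\<^sub>E B" for \<rho> \<sigma>
    using that permutes_in_image[OF that(1)] by (auto simp: PiE_def extensional_def Pi_def)
  show "(\<lambda>\<sigma>. \<sigma> \<circ> \<pi>) \<in> (A \<rightarrow>\<^sub>E B) \<rightarrow> (A \<rightarrow>\<^sub>E B)" using *[OF assms] by auto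
  show "(\<lambda>\<sigma>. \<sigma> \<circ> inv \<pi>) \<in> (A \<rightarrow>\<^sub>E B) \<rightarrow> (A \<rightarrow>\<^sub>E B)" using *[OF permutes_inv[OF assms]] by auto
qed (simp_all add: comp_assoc permutes_inv_o[OF assms])

lemma exists_permutes_pair:
  assumes "i \<in> A" "j \<in> A" "i \<noteq> j" "a \<in> A" "b \<in> A" "a \<noteq> b"
  shows "\<exists>\<pi>. \<pi> permutes A \<and> \<pi> i = a \<and> \<pi> j = b"
proof (intro exI conjI)
  \<comment> \<open>The first transposition sends i to a, the second moves the image of j to b.
    Neither that image nor b equals a, so a stays fixed.\<close>
  let ?j = "Transposition.transpose i a j"
  have j: "?j \<in> A" "?j \<noteq> a" using assms by (auto simp: Transposition.transpose_def)
  let ?\<pi> = "Transposition.transpose ?j b \<circ> Transposition.transpose i a"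
  show "?\<pi> permutes A" using assms j by (intro permutes_compose permutes_swap_id)
  show "?\<pi> i = a" "?\<pi> j = b" using assms j by (auto simp: Transposition.transpose_def)
qed

lemma total_overlap_comp_permutes:
  assumes "\<pi> permutes A"
  shows "total_overlap A B (\<sigma> \<circ> \<pi>) (\<tau> \<circ> \<pi>) = total_overlap A B \<sigma> \<tau>"
proof -
  have "total_overlap A B (\<sigma> \<circ> \<pi>) (\<tau> \<circ> \<pi>) = (\<Sum>a\<in>A. \<Sum>b\<in>A. overlap B (\<pi> a) (\<pi> b) \<sigma> \<tau>)"
    by (simp add: total_overlap_def overlap_def)
  also have "\<dots> = (\<Sum>a\<in>A. \<Sum>b\<in>A. overlap B (\<pi> a) b \<sigma> \<tau>)"
  proof (rule sum.cong[OF refl])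
    fix a
    show "(\<Sum>b\<in>A. overlap B (\<pi> a) (\<pi> b) \<sigma> \<tau>) = (\<Sum>b\<in>A. overlap B (\<pi> a) b \<sigma> \<tau>)"
      using sum.permute[OF assms, of "\<lambda>b. overlap B (\<pi> a) b \<sigma> \<tau>"] by (simp add: comp_def)
  qed
  also have "\<dots> = total_overlap A B \<sigma> \<tau>"
    using sum.permute[OF assms, of "\<lambda>a. \<Sum>b\<in>A. overlap B a b \<sigma> \<tau>"]
    by (simp add: total_overlap_def comp_def)
  finally show ?thesis .
qed

text \<open>Both replicas are relabelled by one permutation carrying i, j to a, b; this preserves
  the set of labellings and the total overlap.\<close>

lemma overlap_sum_exchangeable:
  fixes G :: "real \<Rightarrow> real"
  assumes "i \<in> A" "j \<in> A" "i \<noteq> j" "a \<in> A" "b \<in> A" "a \<noteq> b"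
  shows "(\<Sum>\<sigma>\<in>A \<rightarrow>\<^sub>E B. \<Sum>\<tau>\<in>A \<rightarrow>\<^sub>E B. overlap B a b \<sigma> \<tau> * G (total_overlap A B \<sigma> \<tau>)) =
    (\<Sum>\<sigma>\<in>A \<rightarrow>\<^sub>E B. \<Sum>\<tau>\<in>A \<rightarrow>\<^sub>E B. overlap B i j \<sigma> \<tau> * G (total_overlap A B \<sigma> \<tau>))"
proof -
  obtain \<pi> where \<pi>: "\<pi> permutes A" "\<pi> i = a" "\<pi> j = b"
    using exists_permutes_pair[OF assms] by blast
  note bij = bij_betw_comp_permutes[OF \<pi>(1), of B]
  have reindex: "(\<Sum>\<sigma>\<in>A \<rightarrow>\<^sub>E B. \<Sum>\<tau>\<in>A \<rightarrow>\<^sub>E B. F \<sigma> \<tau>) =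
      (\<Sum>\<sigma>\<in>A \<rightarrow>\<^sub>E B. \<Sum>\<tau>\<in>A \<rightarrow>\<^sub>E B. F (\<sigma> \<circ> \<pi>) (\<tau> \<circ> \<pi>))" for F :: "_ \<Rightarrow> _ \<Rightarrow> real"
    using sum.reindex_bij_betw[OF bij, of "\<lambda>\<sigma>. \<Sum>\<tau>\<in>A \<rightarrow>\<^sub>E B. F \<sigma> \<tau>"]
      sum.reindex_bij_betw[OF bij, of "F \<sigma>" for \<sigma>] by simp
  have "(\<Sum>\<sigma>\<in>A \<rightarrow>\<^sub>E B. \<Sum>\<tau>\<in>A \<rightarrow>\<^sub>E B. overlap B i j \<sigma> \<tau> * G (total_overlap A B \<sigma> \<tau>)) =
      (\<Sum>\<sigma>\<in>A \<rightarrow>\<^sub>E B. \<Sum>\<tau>\<in>A \<rightarrow>\<^sub>E B. overlap B i j (\<sigma> \<circ> \<pi>) (\<tau> \<circ> \<pi>) * G (total_overlap A B (\<sigma> \<circ> \<pi>) (\<tau> \<circ> \<pi>)))"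
    by (rule reindex)
  also have "\<dots> = (\<Sum>\<sigma>\<in>A \<rightarrow>\<^sub>E B. \<Sum>\<tau>\<in>A \<rightarrow>\<^sub>E B. overlap B a b \<sigma> \<tau> * G (total_overlap A B \<sigma> \<tau>))"
    unfolding total_overlap_comp_permutes[OF \<pi>(1)] by (simp add: overlap_def \<pi>)
  finally show ?thesis by simp
qed

text \<open>By exchangeability the pair i, j is replaced by the average over all pairs; this is the
  source of the factor 1/n.\<close>

lemma overlap_sum_average_le:
  fixes G :: "real \<Rightarrow> real"
  assumes A: "finite A" and B: "finite B" and ij: "i \<in> A" "j \<in> A" "i \<noteq> j"
    and G: "\<And>z. 0 \<le> z \<Longrightarrow> 0 \<le> G z"
  shows "real (card A) * (real (card A) - 1) *
      (\<Sum>\<sigma>\<in>A \<rightarrow>\<^sub>E B. \<Sum>\<tau>\<in>A \<rightarrow>\<^sub>E B. overlap B i j \<sigma> \<tau> * G (total_overlap A B \<sigma> \<tau>)) \<le>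
    (\<Sum>\<sigma>\<in>A \<rightarrow>\<^sub>E B. \<Sum>\<tau>\<in>A \<rightarrow>\<^sub>E B. total_overlap A B \<sigma> \<tau> * G (total_overlap A B \<sigma> \<tau>))"
proof -
  let ?\<Omega> = "A \<rightarrow>\<^sub>E B"
  define H where "H a b = (\<Sum>\<sigma>\<in>?\<Omega>. \<Sum>\<tau>\<in>?\<Omega>. overlap B a b \<sigma> \<tau> * G (total_overlap A B \<sigma> \<tau>))" for a b
  have G0: "0 \<le> G (total_overlap A B \<sigma> \<tau>)" if "\<sigma> \<in> ?\<Omega>" "\<tau> \<in> ?\<Omega>" for \<sigma> \<tau>
    using that by (intro G) (simp add: total_overlap_eq_cell_sums[OF B] sum_nonneg)
  have "real (card A) * (real (card A) - 1) * H i j = (\<Sum>a\<in>A. \<Sum>b\<in>A - {a}. H i j)"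
  proof -
    have "(\<Sum>b\<in>A - {a}. H i j) = (real (card A) - 1) * H i j" if "a \<in> A" for a
    proof -
      have "real (card (A - {a})) = real (card A) - 1"
        using card.remove[OF A that] by simp
      then show ?thesis by simp
    qed
    then have "(\<Sum>a\<in>A. \<Sum>b\<in>A - {a}. H i j) = (\<Sum>a\<in>A. (real (card A) - 1) * H i j)"
      by (rule sum.cong[OF refl])
    then show ?thesis by (simp only: sum_constant mult.assoc)
  qed
  also have "\<dots> = (\<Sum>a\<in>A. \<Sum>b\<in>A - {a}. H a b)"
    unfolding H_def by (intro sum.cong refl overlap_sum_exchangeable[symmetric] ij) auto
  \<comment> \<open>Restoring the diagonal adds only nonnegative terms.\<close>
  also have "\<dots> \<le> (\<Sum>a\<in>A. \<Sum>b\<in>A. H a b)"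
  proof (rule sum_mono)
    fix a assume a: "a \<in> A"
    have "0 \<le> H a a"
      unfolding H_def by (intro sum_nonneg mult_nonneg_nonneg overlap_diag_nonneg G0)
    then show "(\<Sum>b\<in>A - {a}. H a b) \<le> (\<Sum>b\<in>A. H a b)"
      using sum.remove[OF A a, of "H a"] by simp
  qed
  also have "\<dots> = (\<Sum>\<sigma>\<in>?\<Omega>. \<Sum>\<tau>\<in>?\<Omega>. total_overlap A B \<sigma> \<tau> * G (total_overlap A B \<sigma> \<tau>))"
  proof -
    have mult: "total_overlap A B \<sigma> \<tau> * g = (\<Sum>a\<in>A. \<Sum>b\<in>A. overlap B a b \<sigma> \<tau> * g)" for \<sigma> \<tau> g
      by (simp add: total_overlap_def sum_distrib_right)
    show ?thesis
      unfolding H_def mult by (subst sum_rotate, intro sum.cong refl, rule sum_rotate)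
  qed
  finally show ?thesis by (simp add: H_def)
qed

text \<open>Chains the replica comparison, the averaging over pairs and the moment bound. Absorbing
  the total overlap raises the truncation from D to D+1, hence D+1 in the condition on
  \<open>r\<close> and D+2 in the result.\<close>

lemma sum_correlations_bound:
  fixes \<mu> r :: real
  assumes n: "n \<ge> 2" and B: "finite B" "B \<noteq> {}" and ij: "i \<in> {1..n}" "j \<in> {1..n}" "i \<noteq> j"
    and \<kappa>: "\<kappa> = real n * exp r / (real (card B))\<^sup>2"
    and \<mu>: "0 < \<mu>" "\<mu> * \<kappa> \<le> 1"
    and r: "sqrt (2 * real (D + 1) / \<kappa>) \<le> r / (real (card B))\<^sup>2"
  shows "(\<Sum>R | R \<subseteq> vertex_pairs n \<and> card R \<le> D. \<mu> ^ card R *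
      (\<Sum>\<sigma>\<in>{1..n} \<rightarrow>\<^sub>E B. agreement B (\<sigma> i) (\<sigma> j) *
        (\<Prod>e\<in>R. agreement B (\<sigma> (fst e)) (\<sigma> (snd e))))\<^sup>2) \<le>
    (real (card ({1..n} \<rightarrow>\<^sub>E B)))\<^sup>2 * (2 * real (D + 1) / (\<mu> * real n * (real n - 1)) *
      (exp 1 * (real (D + 2))\<^sup>2) ^ (card B)\<^sup>2)" (is "?M \<le> ?K * (_ * ?E)")
proof -
  let ?\<Omega> = "{1..n} \<rightarrow>\<^sub>E B"
  let ?Q = "total_overlap {1..n} B"
  have Q0: "0 \<le> ?Q \<sigma> \<tau>" if "\<sigma> \<in> ?\<Omega>" "\<tau> \<in> ?\<Omega>" for \<sigma> \<tau>
    using that by (simp add: total_overlap_eq_cell_sums[OF B(1)] sum_nonneg)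
  have "?M \<le> (\<Sum>\<sigma>\<in>?\<Omega>. \<Sum>\<tau>\<in>?\<Omega>. overlap B i j \<sigma> \<tau> * truncated_exp D (\<mu> / 2 * ?Q \<sigma> \<tau>))" (is "_ \<le> ?N")
    using \<mu> by (intro sum_correlations_le) simp
  moreover have "real n * (real n - 1) * ?N \<le>
      (\<Sum>\<sigma>\<in>?\<Omega>. \<Sum>\<tau>\<in>?\<Omega>. ?Q \<sigma> \<tau> * truncated_exp D (\<mu> / 2 * ?Q \<sigma> \<tau>))"
    using overlap_sum_average_le[of "{1..n}" B i j "\<lambda>z. truncated_exp D (\<mu> / 2 * z)"] B ij \<mu>
    by (simp add: truncated_exp_nonneg)
  moreover have "(\<Sum>\<sigma>\<in>?\<Omega>. \<Sum>\<tau>\<in>?\<Omega>. ?Q \<sigma> \<tau> * truncated_exp D (\<mu> / 2 * ?Q \<sigma> \<tau>)) \<le>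
      2 * real (D + 1) / \<mu> * (?K * ?E)"
  proof -
    have "(\<Sum>\<sigma>\<in>?\<Omega>. \<Sum>\<tau>\<in>?\<Omega>. ?Q \<sigma> \<tau> * truncated_exp D (\<mu> / 2 * ?Q \<sigma> \<tau>)) \<le>
        (\<Sum>\<sigma>\<in>?\<Omega>. \<Sum>\<tau>\<in>?\<Omega>. 2 * real (D + 1) / \<mu> * truncated_exp (D + 1) (\<mu> / 2 * ?Q \<sigma> \<tau>))"
    proof (intro sum_mono)
      fix \<sigma> \<tau> assume "\<sigma> \<in> ?\<Omega>" "\<tau> \<in> ?\<Omega>"
      then have "0 \<le> \<mu> / 2 * ?Q \<sigma> \<tau>" using \<mu> Q0 by simp
      from mult_truncated_exp_le[OF this, of D] \<mu>
      show "?Q \<sigma> \<tau> * truncated_exp D (\<mu> / 2 * ?Q \<sigma> \<tau>) \<le>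
          2 * real (D + 1) / \<mu> * truncated_exp (D + 1) (\<mu> / 2 * ?Q \<sigma> \<tau>)"
        by (simp add: field_simps)
    qed
    also have "\<dots> = 2 * real (D + 1) / \<mu> *
        (\<Sum>\<sigma>\<in>?\<Omega>. \<Sum>\<tau>\<in>?\<Omega>. truncated_exp (D + 1) (\<mu> / 2 * (\<Sum>c\<in>B\<times>B. (cell_sum {1..n} B \<sigma> \<tau> c)\<^sup>2)))"
      unfolding sum_distrib_left[of "2 * real (D + 1) / \<mu>"]
      by (intro sum.cong refl) (simp add: total_overlap_eq_cell_sums[OF B(1)])
    also have "\<dots> \<le> 2 * real (D + 1) / \<mu> * (?K * (exp 1 * (real (D + 1 + 1))\<^sup>2) ^ (card B)\<^sup>2)"
      using n B \<kappa> \<mu> r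
      by (intro mult_left_mono cell_sum_truncated_exp[where r = r and \<kappa> = \<kappa>]) auto
    finally show ?thesis by (simp add: add.assoc)
  qed
  ultimately have "real n * (real n - 1) * ?N \<le> 2 * real (D + 1) / \<mu> * (?K * ?E)"
    by linarith
  moreover have nn: "real n * (real n - 1) > 0" using n by simp
  ultimately have "?N \<le> 2 * real (D + 1) / \<mu> * (?K * ?E) / (real n * (real n - 1))"
    by (subst pos_le_divide_eq) (simp_all add: mult.commute)
  also have "\<dots> = ?K * (2 * real (D + 1) / (\<mu> * real n * (real n - 1)) * ?E)"
    by (simp add: mult_ac)
  finally show ?thesis using \<open>?M \<le> ?N\<close> by linarith
qed

section \<open>From random graphs to sums over labellings\<close>

lemma independent_edges_pmf_eq:
  "independent_edges_pmf n P = map_pmf graph_of_edges (edge_pmf (vertex_pairs n) (\<lambda>e. P (fst e) (snd e)))"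
  by (simp add: independent_edges_pmf_def edge_pmf_def split_def)

lemma multilinear_expansion_coeff: "multilinear_expansion n f (multilinear_coeff n f)"
  unfolding multilinear_coeff_def by (rule theI'[OF multilinear_expansion_ex1])

lemma multilinear_coeff_eq_0:
  assumes "card S > multilinear_degree n f"
  shows "multilinear_coeff n f S = 0"
proof (rule ccontr)
  assume "multilinear_coeff n f S \<noteq> 0"
  have "{S. multilinear_coeff n f S \<noteq> 0} \<subseteq> Pow (vertex_pairs n)"
    using multilinear_expansion_coeff[of n f] by (auto simp: multilinear_expansion_def)
  then have "finite {S. multilinear_coeff n f S \<noteq> 0}"
    by (rule finite_subset) (simp add: finite_vertex_pairs)
  then have "card S \<le> multilinear_degree n f"
    unfolding multilinear_degree_def using \<open>multilinear_coeff n f S \<noteq> 0\<close> by (intro Max_ge) auto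
  then show False using assms by simp
qed

text \<open>Draws vanish outside \<open>vertex_pairs n\<close>, so they give genuine adjacency
  matrices, on which the multilinear expansion represents \<open>f\<close>. The outer function
  \<open>g\<close> serves both the mean and the second moment.\<close>

lemma expectation_independent_edges:
  fixes g :: "real \<Rightarrow> real"
  shows "measure_pmf.expectation (independent_edges_pmf n P) (\<lambda>x. g (f x)) =
    measure_pmf.expectation (edge_pmf (vertex_pairs n) (\<lambda>e. P (fst e) (snd e)))
      (\<lambda>E. g (\<Sum>S\<in>Pow (vertex_pairs n). multilinear_coeff n f S * (\<Prod>e\<in>S. of_bool (E e))))"
proof -
  have eq: "f (graph_of_edges E) =
      (\<Sum>S\<in>Pow (vertex_pairs n). multilinear_coeff n f S * (\<Prod>e\<in>S. of_bool (E e)))"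
    if E: "E \<in> set_pmf (edge_pmf (vertex_pairs n) Q)" for E and Q :: "nat \<times> nat \<Rightarrow> real"
  proof -
    have off: "\<not> E e" if "e \<notin> vertex_pairs n" for e
      using E set_Pi_pmf_subset[OF finite_vertex_pairs, of n False] that
      unfolding edge_pmf_def by blast
    have "graph_of_edges E \<in> adjacency_matrices n"
      using off unfolding adjacency_matrices_def graph_of_edges_def vertex_pairs_def
      by (fastforce simp: min_def max_def split: if_splits)
    then have "f (graph_of_edges E) = multilinear_eval n (multilinear_coeff n f) (graph_of_edges E)"
      using multilinear_expansion_coeff[of n f] by (simp add: multilinear_expansion_def)
    also have "\<dots> = (\<Sum>S\<in>Pow (vertex_pairs n). multilinear_coeff n f S * (\<Prod>e\<in>S. of_bool (E e)))"
      unfolding multilinear_eval_def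
      by (intro sum.cong refl arg_cong2[where f = "(*)"] prod.cong)
        (auto simp: vertex_pairs_def graph_of_edges_def min_def max_def)
    finally show ?thesis .
  qed
  show ?thesis
    unfolding independent_edges_pmf_eq integral_map_pmf
    by (intro integral_cong_AE) (auto simp: AE_measure_pmf_iff eq)
qed

lemma expectation_sbm:
  assumes "k \<ge> 1"
  shows "measure_pmf.expectation (sbm n d \<epsilon> k) (\<lambda>(x, \<sigma>). f x * g \<sigma>) =
    (\<Sum>\<sigma>\<in>{1..n} \<rightarrow>\<^sub>E {1..k}. g \<sigma> * measure_pmf.expectation (independent_edges_pmf n
      (\<lambda>a b. if \<sigma> a = \<sigma> b then sbm_prob_same n d \<epsilon> k else sbm_prob_diff n d \<epsilon> k)) f) /
      real (card ({1..n} \<rightarrow>\<^sub>E {1..k}))"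
proof -
  have ne: "{1..n} \<rightarrow>\<^sub>E {1..k} \<noteq> {}" using assms by (auto simp: PiE_eq_empty_iff)
  have fin: "finite ({1..n} \<rightarrow>\<^sub>E {1..k})" by (intro finite_PiE) auto
  have fin': "finite (set_pmf (independent_edges_pmf n P))" for P
    unfolding independent_edges_pmf_eq by (simp add: finite_set_edge_pmf finite_vertex_pairs)
  show ?thesis
    unfolding sbm_def
    by (subst pmf_expectation_bind_pmf_of_set[OF ne fin])
      (auto simp: fin' sum_distrib_left divide_inverse mult_ac intro!: sum.cong)
qed

text \<open>Each edge contributes (\<epsilon>p)^2 from the squared deviations and 1/(p(1-p)) from
  the norm of the monomial, with p = d/n; the product of the two is \<mu>.\<close>

lemma sbm_correlation_bound:
  fixes d \<epsilon> r :: real and f :: "(nat \<Rightarrow> nat \<Rightarrow> bool) \<Rightarrow> real"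
  assumes n: "n \<ge> 2" and k: "k \<ge> 1" and ij: "i \<in> {1..n}" "j \<in> {1..n}" "i \<noteq> j"
    and \<epsilon>: "\<epsilon> > 0" and p: "0 < d / real n" "d / real n < 1"
    and valid: "sbm_prob_same n d \<epsilon> k \<in> {0..1}" "sbm_prob_diff n d \<epsilon> k \<in> {0..1}"
    and \<mu>: "\<mu> = \<epsilon>\<^sup>2 * (d / real n) / (1 - d / real n)"
    and \<kappa>: "\<kappa> = real n * exp r / (real k)\<^sup>2" "\<mu> * \<kappa> \<le> 1"
    and D: "D = multilinear_degree n f"
    and r: "sqrt (2 * real (D + 1) / \<kappa>) \<le> r / (real k)\<^sup>2"
  shows "(measure_pmf.expectation (sbm n d \<epsilon> k)
      (\<lambda>(x, \<sigma>). f x * (of_bool (\<sigma> i = \<sigma> j) - 1 / real k)))\<^sup>2 \<le>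
    measure_pmf.expectation (erdos_renyi n (d / real n)) (\<lambda>x. (f x)\<^sup>2) *
      (2 * real (D + 1) / (\<mu> * real n * (real n - 1)) * (exp 1 * (real (D + 2))\<^sup>2) ^ k\<^sup>2)"
proof -
  let ?B = "{1..k}" and ?V = "vertex_pairs n" and ?p = "d / real n"
  let ?\<Omega> = "{1..n} \<rightarrow>\<^sub>E ?B"
  let ?bound = "2 * real (D + 1) / (\<mu> * real n * (real n - 1)) * (exp 1 * (real (D + 2))\<^sup>2) ^ k\<^sup>2"
  define F where "F = (\<lambda>E. \<Sum>S\<in>Pow ?V. multilinear_coeff n f S * (\<Prod>e\<in>S. of_bool (E e)))"
  define P where "P \<sigma> e = (if \<sigma> (fst e) = \<sigma> (snd e) then sbm_prob_same n d \<epsilon> k else sbm_prob_diff n d \<epsilon> k)"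
    for \<sigma> :: "nat \<Rightarrow> nat" and e :: "nat \<times> nat"
  define h where "h \<sigma> = agreement ?B (\<sigma> i) (\<sigma> j)" for \<sigma>
  define m where "m = (\<Sum>\<sigma>\<in>?\<Omega>. h \<sigma> * measure_pmf.expectation (edge_pmf ?V (P \<sigma>)) F)"
  define E2 where "E2 = measure_pmf.expectation (erdos_renyi n ?p) (\<lambda>x. (f x)\<^sup>2)"
  have "0 < 1 - ?p" using p by simp
  then have \<mu>0: "\<mu> > 0"
    unfolding \<mu> by (rule divide_pos_pos[OF mult_pos_pos[OF zero_less_power[OF \<epsilon>] p(1)]])
  have E2: "E2 = measure_pmf.expectation (edge_pmf ?V (\<lambda>_. ?p)) (\<lambda>E. (F E)\<^sup>2)"
    unfolding E2_def erdos_renyi_def F_def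
    using expectation_independent_edges[where g = "\<lambda>x. x\<^sup>2"] by simp
  have E2_0: "E2 \<ge> 0" unfolding E2_def by simp
  have Ef: "measure_pmf.expectation (independent_edges_pmf n
      (\<lambda>a b. if \<sigma> a = \<sigma> b then sbm_prob_same n d \<epsilon> k else sbm_prob_diff n d \<epsilon> k)) f =
      measure_pmf.expectation (edge_pmf ?V (P \<sigma>)) F" for \<sigma>
    using expectation_independent_edges[where g = "\<lambda>x. x" and f = f and n = n and
        P = "\<lambda>a b. if \<sigma> a = \<sigma> b then sbm_prob_same n d \<epsilon> k else sbm_prob_diff n d \<epsilon> k"]
    by (simp add: F_def P_def[abs_def])
  have h: "of_bool (\<sigma> i = \<sigma> j) - 1 / real k = h \<sigma>" for \<sigma>
    by (simp add: h_def agreement_def)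
  have lhs: "measure_pmf.expectation (sbm n d \<epsilon> k)
      (\<lambda>(x, \<sigma>). f x * (of_bool (\<sigma> i = \<sigma> j) - 1 / real k)) = m / real (card ?\<Omega>)"
    unfolding h expectation_sbm[OF k] Ef m_def by (rule refl)
  have "m\<^sup>2 \<le> E2 * (\<Sum>R | R \<subseteq> ?V \<and> card R \<le> D.
      (\<Sum>\<sigma>\<in>?\<Omega>. h \<sigma> * (\<Prod>e\<in>R. P \<sigma> e - ?p))\<^sup>2 / (?p * (1 - ?p)) ^ card R)"
    unfolding m_def E2
  proof (rule low_degree_Cauchy_Schwarz[OF finite_vertex_pairs _ p _ F_def])
    show "multilinear_coeff n f S = 0" if "D < card S" for S
      using that multilinear_coeff_eq_0 unfolding D by blast
    show "P \<sigma> e \<in> {0..1}" for \<sigma> e using valid by (simp add: P_def)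
  qed
  also have "(\<Sum>R | R \<subseteq> ?V \<and> card R \<le> D.
      (\<Sum>\<sigma>\<in>?\<Omega>. h \<sigma> * (\<Prod>e\<in>R. P \<sigma> e - ?p))\<^sup>2 / (?p * (1 - ?p)) ^ card R) =
    (\<Sum>R | R \<subseteq> ?V \<and> card R \<le> D. \<mu> ^ card R *
      (\<Sum>\<sigma>\<in>?\<Omega>. agreement ?B (\<sigma> i) (\<sigma> j) * (\<Prod>e\<in>R. agreement ?B (\<sigma> (fst e)) (\<sigma> (snd e))))\<^sup>2)"
  proof (rule sum.cong[OF refl])
    fix R
    define T where "T = (\<Sum>\<sigma>\<in>?\<Omega>. h \<sigma> * (\<Prod>e\<in>R. agreement ?B (\<sigma> (fst e)) (\<sigma> (snd e))))"
    have "P \<sigma> e - ?p = \<epsilon> * ?p * agreement ?B (\<sigma> (fst e)) (\<sigma> (snd e))" for \<sigma> e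
      by (simp add: P_def sbm_prob_same_def sbm_prob_diff_def agreement_def
          algebra_simps add_divide_distrib)
    then have "(\<Prod>e\<in>R. P \<sigma> e - ?p) =
        (\<epsilon> * ?p) ^ card R * (\<Prod>e\<in>R. agreement ?B (\<sigma> (fst e)) (\<sigma> (snd e)))" for \<sigma>
      by (simp only: prod.distrib prod_constant power_mult_distrib)
    then have "(\<Sum>\<sigma>\<in>?\<Omega>. h \<sigma> * (\<Prod>e\<in>R. P \<sigma> e - ?p)) = (\<epsilon> * ?p) ^ card R * T"
      by (simp only: T_def sum_distrib_left mult.left_commute)
    then have "(\<Sum>\<sigma>\<in>?\<Omega>. h \<sigma> * (\<Prod>e\<in>R. P \<sigma> e - ?p))\<^sup>2 / (?p * (1 - ?p)) ^ card R =
        ((\<epsilon> * ?p)\<^sup>2) ^ card R / (?p * (1 - ?p)) ^ card R * T\<^sup>2"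
      by (simp add: power_mult_distrib power_mult[symmetric] mult.commute)
    also have "((\<epsilon> * ?p)\<^sup>2) ^ card R / (?p * (1 - ?p)) ^ card R = \<mu> ^ card R"
    proof -
      have "(\<epsilon> * ?p)\<^sup>2 / (?p * (1 - ?p)) = \<mu>"
        unfolding \<mu> using p(1) by (simp only: power_mult_distrib power2_eq_square) auto
      then show ?thesis by (simp only: power_divide[symmetric])
    qed
    finally show "(\<Sum>\<sigma>\<in>?\<Omega>. h \<sigma> * (\<Prod>e\<in>R. P \<sigma> e - ?p))\<^sup>2 / (?p * (1 - ?p)) ^ card R =
      \<mu> ^ card R * (\<Sum>\<sigma>\<in>?\<Omega>. agreement ?B (\<sigma> i) (\<sigma> j) *
        (\<Prod>e\<in>R. agreement ?B (\<sigma> (fst e)) (\<sigma> (snd e))))\<^sup>2"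
      by (simp add: T_def h_def)
  qed
  also have "E2 * \<dots> \<le> E2 * ((real (card ?\<Omega>))\<^sup>2 * ?bound)"
    using sum_correlations_bound[of n ?B i j \<kappa> r \<mu> D] n k ij \<kappa> \<mu>0 r E2_0
    by (intro mult_left_mono) auto
  finally have "m\<^sup>2 \<le> (real (card ?\<Omega>))\<^sup>2 * (E2 * ?bound)" by (simp add: mult_ac)
  moreover have "real (card ?\<Omega>) > 0" using k by (simp add: card_PiE)
  ultimately have "(m / real (card ?\<Omega>))\<^sup>2 \<le> E2 * ?bound"
    by (simp add: power_divide pos_divide_le_eq mult.commute)
  then show ?thesis unfolding lhs E2_def .
qed

subsection \<open>The low-degree lower bound\<close>

theorem theorem1p10:
  fixes d \<epsilon> :: real and k :: nat
  assumes "d > 0" and "\<epsilon> > 0" and "k \<ge> 2"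
    and "\<forall>\<^sub>F n in sequentially.
           sbm_prob_same n d \<epsilon> k \<in> {0..1} \<and> sbm_prob_diff n d \<epsilon> k \<in> {0..1}"
  shows "\<exists>c>0. \<forall>\<delta>>0. \<epsilon>\<^sup>2 * d < (1 - \<delta>) * (real k)\<^sup>2 \<longrightarrow>
    (\<forall>(f :: nat \<Rightarrow> (nat \<Rightarrow> nat \<Rightarrow> bool) \<Rightarrow> real) (i :: nat \<Rightarrow> nat) (j :: nat \<Rightarrow> nat).
       (\<forall>\<^sub>F n in sequentially. i n \<in> {1..n} \<and> j n \<in> {1..n} \<and> i n \<noteq> j n) \<longrightarrow>
       (\<forall>\<^sub>F n in sequentially.
          measure_pmf.expectation (erdos_renyi n (d / real n)) (f n) = 0) \<longrightarrow>
       (\<exists>\<eta>>0. \<forall>\<^sub>F n in sequentially.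
          measure_pmf.expectation (sbm n d \<epsilon> k)
              (\<lambda>(x, \<sigma>). f n x * (of_bool (\<sigma> (i n) = \<sigma> (j n)) - 1 / real k))
            / sqrt (measure_pmf.expectation (erdos_renyi n (d / real n)) (\<lambda>x. (f n x)\<^sup>2))
          \<ge> \<eta>) \<longrightarrow>
       (\<forall>\<^sub>F n in sequentially. real (multilinear_degree n (f n)) \<ge> real n powr c))"
proof -
  \<comment> \<open>The final bound is of order D^(2k^2+1)/n; for D < n^c this exponent makes it of
    order n^(-1/2). It depends on k alone.\<close>
  define c where "c = 1 / (2 * real (2 * k\<^sup>2 + 1))"
  have c0: "c > 0" by (simp add: c_def add_pos_nonneg)
  have k0: "real k > 0" using assms(3) by simp
  show ?thesis
  proof (intro exI[of _ c] conjI c0 allI impI)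
    fix \<delta> :: real and f :: "nat \<Rightarrow> (nat \<Rightarrow> nat \<Rightarrow> bool) \<Rightarrow> real" and i j :: "nat \<Rightarrow> nat"
    assume \<delta>: "\<delta> > 0" and KS: "\<epsilon>\<^sup>2 * d < (1 - \<delta>) * (real k)\<^sup>2"
      and ij: "\<forall>\<^sub>F n in sequentially. i n \<in> {1..n} \<and> j n \<in> {1..n} \<and> i n \<noteq> j n"
    assume "\<exists>\<eta>>0. \<forall>\<^sub>F n in sequentially.
        measure_pmf.expectation (sbm n d \<epsilon> k)
            (\<lambda>(x, \<sigma>). f n x * (of_bool (\<sigma> (i n) = \<sigma> (j n)) - 1 / real k))
          / sqrt (measure_pmf.expectation (erdos_renyi n (d / real n)) (\<lambda>x. (f n x)\<^sup>2)) \<ge> \<eta>"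
    then obtain \<eta> where \<eta>: "\<eta> > 0" and corr: "\<forall>\<^sub>F n in sequentially.
        measure_pmf.expectation (sbm n d \<epsilon> k)
            (\<lambda>(x, \<sigma>). f n x * (of_bool (\<sigma> (i n) = \<sigma> (j n)) - 1 / real k))
          / sqrt (measure_pmf.expectation (erdos_renyi n (d / real n)) (\<lambda>x. (f n x)\<^sup>2)) \<ge> \<eta>"
      by blast
    \<comment> \<open>The signal-to-noise ratio relative to the Kesten--Stigum threshold.\<close>
    define \<beta> where "\<beta> = \<epsilon>\<^sup>2 * d / (real k)\<^sup>2"
    have \<beta>: "0 < \<beta>" "\<beta> < 1"
    proof -
      show "0 < \<beta>" using assms k0 by (simp add: \<beta>_def)
      have "(1 - \<delta>) * (real k)\<^sup>2 \<le> 1 * (real k)\<^sup>2" using \<delta> by (intro mult_right_mono) auto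
      then have "\<epsilon>\<^sup>2 * d < (real k)\<^sup>2" using KS by linarith
      then show "\<beta> < 1" using k0 by (simp add: \<beta>_def)
    qed
    \<comment> \<open>Then \<beta> exp r = sqrt \<beta> < 1, which leaves slack for the factor
      1/(1-p).\<close>
    define r where "r = - ln \<beta> / 2"
    have r0: "r > 0" using \<beta> by (simp add: r_def)
    have \<beta>r: "\<beta> * exp r < 1"
    proof -
      have "\<beta> * exp r = exp (ln \<beta> + r)" using \<beta> by (simp add: exp_add)
      also have "\<dots> < exp 0" using r0 by (subst exp_less_cancel_iff) (simp add: r_def)
      finally show ?thesis by simp
    qed
    \<comment> \<open>Collects the constants of the final bound once D+1 and D+2 are replaced by 3
      n^c.\<close>
    define C where "C = 2 * exp 1 ^ k\<^sup>2 * 3 ^ (2 * k\<^sup>2 + 1) / (\<epsilon>\<^sup>2 * d)"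
    have ed: "\<epsilon>\<^sup>2 * d > 0" using assms by simp
    have c_lt: "c < 1"
    proof -
      define m where "m = real (2 * k\<^sup>2 + 1)"
      have "1 \<le> m" by (simp add: m_def)
      then have "1 / (2 * m) < 1" by simp
      then show ?thesis by (simp only: c_def m_def)
    qed
    \<comment> \<open>Yields \<beta> exp r <= 1 - p, that is \<mu>\<kappa> <= 1.\<close>
    have ev1: "\<forall>\<^sub>F n in sequentially. d / real n < 1 - \<beta> * exp r"
      by (rule order_tendstoD[OF lim_const_over_n]) (use \<beta>r in simp)
    \<comment> \<open>The Chernoff parameters are at most of order sqrt(n^c/n), which tends to 0
      because c < 1.\<close>
    have ev2: "\<forall>\<^sub>F n in sequentially. 2 * (real n powr c + 1) / (real n * exp r / (real k)\<^sup>2) < (r / (real k)\<^sup>2)\<^sup>2"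
    proof (rule order_tendstoD)
      show "(\<lambda>n. 2 * (real n powr c + 1) / (real n * exp r / (real k)\<^sup>2)) \<longlonglongrightarrow> 0"
        using c0 c_lt k0 by real_asymp
      show "0 < (r / (real k)\<^sup>2)\<^sup>2" using r0 k0 by simp
    qed
    have ev3: "\<forall>\<^sub>F n in sequentially. C * (real n powr (1 / 2) / (real n - 1)) < \<eta>\<^sup>2"
    proof (rule order_tendstoD)
      show "(\<lambda>n. C * (real n powr (1 / 2) / (real n - 1))) \<longlonglongrightarrow> 0"
        by (rule tendsto_mult_right_zero) real_asymp
      show "0 < \<eta>\<^sup>2" using \<eta> by simp
    qed
    show "\<forall>\<^sub>F n in sequentially. real n powr c \<le> real (multilinear_degree n (f n))"
      using ij corr ev1 ev2 ev3 assms(4) eventually_ge_at_top[of 2]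
    proof eventually_elim
      case (elim n)
      define D where "D = multilinear_degree n (f n)"
      define p where "p = d / real n"
      define \<mu> where "\<mu> = \<epsilon>\<^sup>2 * p / (1 - p)"
      define \<kappa> where "\<kappa> = real n * exp r / (real k)\<^sup>2"
      define E2 where "E2 = measure_pmf.expectation (erdos_renyi n p) (\<lambda>x. (f n x)\<^sup>2)"
      define N where "N = measure_pmf.expectation (sbm n d \<epsilon> k)
            (\<lambda>(x, \<sigma>). f n x * (of_bool (\<sigma> (i n) = \<sigma> (j n)) - 1 / real k))"
      define bound where "bound = 2 * real (D + 1) / (\<mu> * real n * (real n - 1)) *
          (exp 1 * (real (D + 2))\<^sup>2) ^ k\<^sup>2"
      have n: "n \<ge> 2" by (rule elim)
      have p: "0 < p" "p < 1 - \<beta> * exp r" using n assms(1) elim by (auto simp: p_def)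
      have p1: "p < 1" using p(2) \<beta>(1) mult_pos_pos[OF \<beta>(1) exp_gt_zero[of r]] by linarith
      have \<kappa>0: "\<kappa> > 0" using n k0 by (simp add: \<kappa>_def)
      have np: "real n * p = d" using n by (simp add: p_def)
      have E2_0: "E2 \<ge> 0" unfolding E2_def by simp
      have ratio: "\<eta> \<le> N / sqrt E2" using elim by (simp add: N_def E2_def p_def)
      \<comment> \<open>Division by 0 yields 0, so a vanishing second moment would contradict the
        lower bound \<eta>.\<close>
      then have E2_pos: "E2 > 0" using \<eta> E2_0 by (cases "E2 = 0") auto
      have \<eta>N: "\<eta>\<^sup>2 * E2 \<le> N\<^sup>2"
      proof -
        have "\<eta> * sqrt E2 \<le> N" using ratio E2_pos by (simp add: pos_le_divide_eq)
        then have "(\<eta> * sqrt E2)\<^sup>2 \<le> N\<^sup>2" using \<eta> E2_0 by (intro power_mono) auto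
        then show ?thesis using E2_0 by (simp add: power_mult_distrib)
      qed
      show "real n powr c \<le> real (multilinear_degree n (f n))"
      proof (rule ccontr)
        assume "\<not> ?thesis"
        then have D: "real D < real n powr c" by (simp add: D_def)
        have "N\<^sup>2 \<le> E2 * bound"
          unfolding N_def E2_def p_def bound_def
        proof (rule sbm_correlation_bound[where r = r and \<kappa> = \<kappa>])
          show "\<mu> = \<epsilon>\<^sup>2 * (d / real n) / (1 - d / real n)" by (simp add: \<mu>_def p_def)
          have "\<mu> * \<kappa> = \<epsilon>\<^sup>2 * (real n * p) / (real k)\<^sup>2 * exp r / (1 - p)"
            by (simp add: \<mu>_def \<kappa>_def mult_ac)
          also have "\<dots> = \<beta> * exp r / (1 - p)" by (simp add: np \<beta>_def)
          also have "\<dots> \<le> 1" using p p1 by (simp add: pos_divide_le_eq)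
          finally show "\<mu> * \<kappa> \<le> 1" .
          have "2 * real (D + 1) / \<kappa> \<le> 2 * (real n powr c + 1) / \<kappa>"
            using D \<kappa>0 by (intro divide_right_mono) auto
          also have "\<dots> \<le> (r / (real k)\<^sup>2)\<^sup>2" using elim by (simp add: \<kappa>_def)
          finally show "sqrt (2 * real (D + 1) / \<kappa>) \<le> r / (real k)\<^sup>2"
            using r0 k0 by (intro real_le_lsqrt) auto
        qed (use elim assms p p1 n in \<open>auto simp: p_def \<kappa>_def D_def\<close>)
        also have "bound \<le> C * (real n powr (1 / 2) / (real n - 1))"
        proof -
          \<comment> \<open>From D < n^c and n^c >= 1 follows D+2 <= 3 n^c.\<close>
          define t where "t = 3 * real n powr c"
          have "real n powr c \<ge> 1" using n c0 by (intro ge_one_powr_ge_zero) auto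
          then have t: "real (D + 1) \<le> t" "real (D + 2) \<le> t" using D by (auto simp: t_def)
          \<comment> \<open>One factor n of the denominator is spent on \<mu>, which is of order
            1/n; the factor n - 1 remains for the decay.\<close>
          have "\<mu> * real n \<ge> \<epsilon>\<^sup>2 * d"
          proof -
            have "\<mu> * real n = \<epsilon>\<^sup>2 * (real n * p) / (1 - p)" by (simp add: \<mu>_def)
            also have "\<dots> = \<epsilon>\<^sup>2 * d / (1 - p)" by (simp only: np)
            also have "\<dots> \<ge> \<epsilon>\<^sup>2 * d" using ed p p1 by (simp add: pos_le_divide_eq mult_left_le)
            finally show ?thesis .
          qed
          then have den: "\<epsilon>\<^sup>2 * d * (real n - 1) \<le> \<mu> * real n * (real n - 1)"
            using n by (intro mult_right_mono) auto
          have pos: "0 < \<epsilon>\<^sup>2 * d * (real n - 1)" by (rule mult_pos_pos[OF ed]) (use n in simp)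
          have "2 * real (D + 1) / (\<mu> * real n * (real n - 1)) \<le> 2 * t / (\<epsilon>\<^sup>2 * d * (real n - 1))"
            by (rule frac_le[OF _ _ pos den]) (use t in auto)
          moreover have "(exp 1 * (real (D + 2))\<^sup>2) ^ k\<^sup>2 \<le> (exp 1 * t\<^sup>2) ^ k\<^sup>2"
            using t by (intro power_mono mult_left_mono) auto
          moreover have "0 \<le> 2 * t / (\<epsilon>\<^sup>2 * d * (real n - 1))"
            using pos t by (intro divide_nonneg_pos) auto
          ultimately have "bound \<le> 2 * t / (\<epsilon>\<^sup>2 * d * (real n - 1)) * (exp 1 * t\<^sup>2) ^ k\<^sup>2"
            unfolding bound_def by (rule mult_mono) simp
          also have "\<dots> = 2 * exp 1 ^ k\<^sup>2 / (\<epsilon>\<^sup>2 * d) * t ^ (2 * k\<^sup>2 + 1) / (real n - 1)"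
            by (simp add: power_mult_distrib power_mult power_add)
          also have "t ^ (2 * k\<^sup>2 + 1) = 3 ^ (2 * k\<^sup>2 + 1) * real n powr (1 / 2)"
          proof -
            have "(real n powr c) ^ (2 * k\<^sup>2 + 1) = real n powr (c * real (2 * k\<^sup>2 + 1))"
              using n by (subst powr_realpow[symmetric]) (auto simp: powr_powr)
            also have "c * real (2 * k\<^sup>2 + 1) = 1 / 2"
            proof -
              define m where "m = real (2 * k\<^sup>2 + 1)"
              have "1 \<le> m" by (simp add: m_def)
              then have "1 / (2 * m) * m = 1 / 2" by simp
              then show ?thesis by (simp only: c_def m_def)
            qed
            finally show ?thesis unfolding t_def power_mult_distrib by simp
          qed
          finally show ?thesis by (simp add: C_def mult_ac)
        qed
        also have "\<dots> < \<eta>\<^sup>2" using elim by simp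
        finally show False using \<eta>N E2_pos by (simp add: mult.commute)
      qed
    qed
  qed
qed

end
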